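(* Let $n \geq 3$. The automorphism group $\mathrm{Aut}(\mathbb{T}_n)$ of the generic $n$-hypertournament $\mathbb{T}_n$ is a simple group.
   Context: Let $n\ge 2$ and let the language consist of a single $n$-ary relation symbol $R$. An $n$-hypertournament is a structure $T$ in this language such that $R$ holds only of $n$-tuples of pairwise distinct elements and such that the automorphism group of each $n$-element substructure is the alternating group on its $n$ elements. (Equivalently: for each $n$-element subset, among the $n!$ orderings of it as an $n$-tuple, $R$ holds for exactly one of the two orbits under even permutations.) The class of finite $n$-hypertournaments is a Fraïssé class; the generic $n$-hypertournament $\mathbb{T}_n$ is its Fraïssé limit, i.e. the unique up to isomorphism countable ultrahomogeneous structure (every isomorphism between finite substructures extends to an automorphism) whose finite substructures are, up to isomorphism, exactly the finite $n$-hypertournaments. *)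

theory Defs
  imports
    "HOL-Combinatorics.Permutations"
    "HOL-Library.Countable_Set"
    "HOL-Algebra.Coset"
begin

text \<open>
  Structures in a language with a single relation symbol: tuples are lists, and the arity
  is imposed by \<open>nary_structure\<close>.
\<close>

record 'a rel_struct =
  univ :: "'a set"
  rel :: "'a list set"

definition nary_structure :: "nat \<Rightarrow> 'a rel_struct \<Rightarrow> bool" where
  "nary_structure n T \<longleftrightarrow> (\<forall>xs \<in> rel T. length xs = n \<and> set xs \<subseteq> univ T)"

definition substructure :: "'a rel_struct \<Rightarrow> 'a set \<Rightarrow> 'a rel_struct" where
  "substructure T A = \<lparr>univ = A, rel = {xs \<in> rel T. set xs \<subseteq> A}\<rparr>"

definition isomorphism :: "('a \<Rightarrow> 'b) \<Rightarrow> 'a rel_struct \<Rightarrow> 'b rel_struct \<Rightarrow> bool" where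
  "isomorphism f S T \<longleftrightarrow>
     bij_betw f (univ S) (univ T) \<and>
     (\<forall>xs. set xs \<subseteq> univ S \<longrightarrow> (xs \<in> rel S \<longleftrightarrow> map f xs \<in> rel T))"

text \<open>
  As in \<^const>\<open>permutes\<close>, an automorphism is the identity outside the universe, so that
  automorphisms with equal values on the universe are equal.
\<close>

definition automorphisms :: "'a rel_struct \<Rightarrow> ('a \<Rightarrow> 'a) set" where
  "automorphisms T = {p. p permutes univ T \<and> isomorphism p T T}"

definition Aut :: "'a rel_struct \<Rightarrow> ('a \<Rightarrow> 'a) monoid" where
  "Aut T = \<lparr>carrier = automorphisms T, monoid.mult = (\<circ>), one = id\<rparr>"

definition hypertournament :: "nat \<Rightarrow> 'a rel_struct \<Rightarrow> bool" where
  "hypertournament n T \<longleftrightarrow>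
     nary_structure n T \<and>
     (\<forall>xs \<in> rel T. distinct xs) \<and>
     (\<forall>A. A \<subseteq> univ T \<and> finite A \<and> card A = n \<longrightarrow>
        automorphisms (substructure T A) = {p. p permutes A \<and> evenperm p})"

definition ultrahomogeneous :: "'a rel_struct \<Rightarrow> bool" where
  "ultrahomogeneous T \<longleftrightarrow>
     (\<forall>A B f. A \<subseteq> univ T \<and> B \<subseteq> univ T \<and> finite A \<and> finite B \<and>
        isomorphism f (substructure T A) (substructure T B) \<longrightarrow>
        (\<exists>p \<in> automorphisms T. \<forall>x \<in> A. p x = f x))"

text \<open>
  The last conjunct ranges over hypertournaments on finite sets of natural numbers, which
  represent all finite hypertournaments up to isomorphism.
\<close>

definition generic_hypertournament :: "nat \<Rightarrow> 'a rel_struct \<Rightarrow> bool" where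
  "generic_hypertournament n T \<longleftrightarrow>
     nary_structure n T \<and>
     countable (univ T) \<and>
     ultrahomogeneous T \<and>
     (\<forall>A. A \<subseteq> univ T \<and> finite A \<longrightarrow> hypertournament n (substructure T A)) \<and>
     (\<forall>S :: nat rel_struct. finite (univ S) \<and> hypertournament n S \<longrightarrow>
        (\<exists>A f. A \<subseteq> univ T \<and> isomorphism f S (substructure T A)))"

text \<open>
  The locale \<open>simple_group\<close> of HOL-Algebra demands \<open>order G > 1\<close>; since the order is a
  natural number that is 0 for infinite groups, it only covers finite groups.
\<close>

definition is_simple_group :: "('g, 'm) monoid_scheme \<Rightarrow> bool" where
  "is_simple_group G \<longleftrightarrow>
     group G \<and> carrier G \<noteq> {\<one>\<^bsub>G\<^esub>} \<and>
     (\<forall>H. H \<lhd> G \<longrightarrow> H = {\<one>\<^bsub>G\<^esub>} \<or> H = carrier G)"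

end

theory Submission
  imports Defs "HOL-Library.Numeral_Type"
begin

text \<open>
  Every automorphism \<open>h\<close> is a product of six conjugates \<open>f\<^sub>c g f\<^sub>c\<inverse>\<close> of any given nontrivial
  automorphism \<open>g\<close>. The \<open>f\<^sub>c\<close> are built simultaneously by back and forth from finite partial
  isomorphisms. For each point \<open>x\<close>, the path that starts at \<open>x\<close> and follows the conjugates in
  turn has to end at \<open>h x\<close>; applying \<open>h\<inverse>\<close> to its end makes it a closed hexagon. Extending
  one \<open>f\<^sub>c\<close> may force a path to be continued at both of its ends, where the type of the next
  point over the current finite data is prescribed. The two ends can be joined because every
  type over a finite set has a realization moved by \<open>g\<close> and because the two types that
  the joining point must realize agree on their common domain whenever all hexagons
  through the points of that domain are complete. It suffices to keep this
  completeness at three alternate corners of the hexagon: an extension then spoils at most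
  one corner, and another corner is available for joining the two ends.
\<close>

section \<open>Alternating predicates and one-point extensions\<close>

text \<open>The type of a new point over a finite set amounts to an orientation of the subsets of
  size \<open>n - 1\<close>, and different subsets are oriented independently. So types can be
  prescribed piecewise, and prescriptions conflict only on one and the same subset. The number six
  comes from the needs of one spoiled corner \<open>k\<close>. Leftwards its path may already be
  defined on edges \<open>k\<close> and \<open>k + 5\<close>. A further existing edge would make a
  link at corner \<open>k + 4\<close>, and completeness there would put the spoiled link on a
  complete hexagon as well. The two ends, both on newly defined edges, then meet at the third
  complete corner \<open>k + 2\<close>. Continuing through edge \<open>k + 5\<close> can spoil
  corner \<open>k + 4\<close> in turn, so completing a path is a recursion that needs a decreasing
  measure. Although \<open>h\<close> enters at one corner only, every corner carries its own
  automorphism \<open>t c\<close>: rotating or reflecting the hexagon then gives a problem of the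
  same form.\<close>

definition alternating :: "nat \<Rightarrow> 'a set \<Rightarrow> ('a list \<Rightarrow> bool) \<Rightarrow> bool" where
  "alternating k A \<tau> \<longleftrightarrow>
     (\<forall>xs a b. distinct xs \<and> length xs = k \<and> set xs \<subseteq> A \<and> a \<in> set xs \<and> b \<in> set xs \<and> a \<noteq> b \<longrightarrow>
        (\<tau> (map (transpose a b) xs) \<longleftrightarrow> \<not> \<tau> xs))"

lemma alternatingD:
  assumes "alternating k A \<tau>" "distinct xs" "length xs = k" "set xs \<subseteq> A"
    "a \<in> set xs" "b \<in> set xs" "a \<noteq> b"
  shows "\<tau> (map (transpose a b) xs) \<longleftrightarrow> \<not> \<tau> xs"
  using assms unfolding alternating_def by blast

lemma set_map_permutes: "p permutes set xs \<Longrightarrow> set (map p xs) = set xs"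
  by (simp add: permutes_image)

lemma distinct_map_permutes: "p permutes A \<Longrightarrow> distinct (map p xs) \<longleftrightarrow> distinct xs"
  by (simp add: distinct_map permutes_inj_on)

lemma alternating_permutes:
  assumes alt: "alternating k A \<tau>"
    and xs: "distinct xs" "length xs = k" "set xs \<subseteq> A" and p: "p permutes set xs"
  shows "\<tau> (map p xs) \<longleftrightarrow> (\<tau> xs \<longleftrightarrow> evenperm p)"
  using p finite_set[of xs]
proof (induction rule: permutes_induct)
  case id
  show ?case by (simp add: evenperm_id)
next
  case (swap a b p)
  have perm: "permutation p" "permutation (transpose a b)"
    using swap.hyps(4) permutation_permutes by (blast intro: finite_set) (rule permutation_swap_id)
  have "\<tau> (map (transpose a b) (map p xs)) \<longleftrightarrow> \<not> \<tau> (map p xs)"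
  proof (rule alternatingD[OF alt])
    show "distinct (map p xs)" using swap.hyps(4) xs(1) by (simp add: distinct_map_permutes)
    show "length (map p xs) = k" using xs by simp
    show "set (map p xs) \<subseteq> A" using swap.hyps(4) xs(3) set_map_permutes by metis
    show "a \<in> set (map p xs)" "b \<in> set (map p xs)"
      using swap.hyps(1,2,4) set_map_permutes by metis+
    show "a \<noteq> b" by fact
  qed
  moreover have "evenperm (transpose a b \<circ> p) \<longleftrightarrow> \<not> evenperm p"
    using swap.hyps(3) perm by (simp add: evenperm_comp evenperm_swap)
  ultimately show ?case using swap.IH by (simp add: comp_def)
qed

lemma ex1_permutes_map:
  assumes "distinct xs" "distinct ys" "set xs = set ys"
  shows "\<exists>!p. p permutes set xs \<and> map p xs = ys"
proof (rule ex_ex1I)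
  have len: "length xs = length ys" using assms by (metis distinct_card)
  define p where "p = (\<lambda>x. if x \<in> set xs then the (map_of (zip xs ys) x) else x)"
  have map_p: "map p xs = ys"
  proof (rule nth_equalityI)
    show "length (map p xs) = length ys" using len by simp
    fix i assume "i < length (map p xs)"
    then have "i < length xs" by simp
    then show "map p xs ! i = ys ! i"
      using assms(1) len by (simp add: p_def map_of_zip_nth)
  qed
  have "bij_betw p (set xs) (set xs)"
    unfolding bij_betw_def
  proof
    show "inj_on p (set xs)" using map_p assms(2) by (metis distinct_map)
    show "p ` set xs = set xs" using map_p assms(3) by (metis list.set_map)
  qed
  then have "p permutes set xs"
    by (rule bij_imp_permutes) (simp add: p_def)
  with map_p show "\<exists>p. p permutes set xs \<and> map p xs = ys" by blast
next
  fix p q assume a: "p permutes set xs \<and> map p xs = ys" "q permutes set xs \<and> map q xs = ys"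
  show "p = q"
  proof
    fix x
    show "p x = q x"
    proof (cases "x \<in> set xs")
      case True
      then show ?thesis using a by (metis map_eq_conv)
    next
      case False
      then show ?thesis using a by (metis permutes_not_in)
    qed
  qed
qed

text \<open>Fix one enumeration of every finite set and compare a tuple with the enumeration of its
  support by the parity of the permutation between them. The result serves as default orientation
  wherever nothing is prescribed.\<close>

lemma ex_alternating: "\<exists>\<tau>. \<forall>k. alternating k UNIV \<tau>"
proof -
  define l :: "'a set \<Rightarrow> 'a list" where "l C = (SOME xs. set xs = C \<and> distinct xs)" for C
  have l: "set (l (set xs)) = set xs" "distinct (l (set xs))" for xs
  proof -
    have "\<exists>ys. set ys = set xs \<and> distinct ys"
      by (rule exI[of _ "remdups xs"]) simp
    then have "set (l (set xs)) = set xs \<and> distinct (l (set xs))"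
      unfolding l_def by (rule someI_ex)
    then show "set (l (set xs)) = set xs" "distinct (l (set xs))" by auto
  qed
  define \<pi> where "\<pi> xs = (THE p. p permutes set xs \<and> map p (l (set xs)) = xs)" for xs
  have ex1: "\<exists>!p. p permutes set xs \<and> map p (l (set xs)) = xs" if "distinct xs" for xs
    using ex1_permutes_map[OF l(2) that l(1)] l(1) by metis
  have \<pi>: "\<pi> xs permutes set xs" "map (\<pi> xs) (l (set xs)) = xs" if "distinct xs" for xs
    using theI'[OF ex1[OF that]] unfolding \<pi>_def by auto
  have "alternating k UNIV (\<lambda>xs. evenperm (\<pi> xs))" for k
    unfolding alternating_def
  proof (intro allI impI, elim conjE)
    fix xs :: "'a list" and a b
    assume xs: "distinct xs" and ab: "a \<in> set xs" "b \<in> set xs" "a \<noteq> b"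
    define ys where "ys = map (transpose a b) xs"
    have tr: "transpose a b permutes set xs" using ab by (simp add: permutes_swap_id)
    have s: "set ys = set xs" unfolding ys_def using tr by (rule set_map_permutes)
    have d: "distinct ys" unfolding ys_def using tr xs by (simp add: distinct_map_permutes)
    have "transpose a b \<circ> \<pi> xs permutes set ys \<and> map (transpose a b \<circ> \<pi> xs) (l (set ys)) = ys"
      using \<pi>[OF xs] tr by (simp add: permutes_compose s) (simp add: ys_def flip: map_map)
    then have "\<pi> ys = transpose a b \<circ> \<pi> xs"
      using ex1[OF d] \<pi>[OF d] by blast
    moreover have "permutation (\<pi> xs)" using \<pi>(1)[OF xs] permutation_permutes by blast
    ultimately show "evenperm (\<pi> (map (transpose a b) xs)) \<longleftrightarrow> \<not> evenperm (\<pi> xs)"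
      using ab(3) by (simp add: evenperm_comp evenperm_swap permutation_swap_id flip: ys_def)
  qed
  then show ?thesis by blast
qed

section \<open>Hypertournaments as alternating predicates\<close>

lemma automorphisms_substructure:
  "automorphisms (substructure T A) =
     {p. p permutes A \<and> (\<forall>xs. set xs \<subseteq> A \<longrightarrow> (xs \<in> rel T \<longleftrightarrow> map p xs \<in> rel T))}"
proof -
  have "set (map p xs) \<subseteq> A" if "p permutes A" "set xs \<subseteq> A" for p xs
    using that by (auto simp: permutes_in_image)
  then show ?thesis
    unfolding automorphisms_def isomorphism_def substructure_def
    by (auto simp: permutes_imp_bij)
qed

text \<open>A transposition is not an automorphism, so it fails on some tuple \<open>ys\<close>,
  though not necessarily on \<open>xs\<close>. Even permutations are automorphisms, and they carry
  the failure from \<open>ys\<close> to \<open>xs\<close>, which enumerates the same set.\<close>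

lemma alternating_of_hypertournament:
  assumes "hypertournament n T"
  shows "alternating n (univ T) (\<lambda>xs. xs \<in> rel T)"
  unfolding alternating_def
proof (intro allI impI, elim conjE)
  fix xs a b
  assume xs: "distinct xs" "length xs = n" "set xs \<subseteq> univ T"
    and ab: "a \<in> set xs" "b \<in> set xs" "a \<noteq> b"
  let ?A = "set xs" and ?t = "transpose a b"
  have card: "card ?A = n" using xs by (simp add: distinct_card)
  have Aut: "automorphisms (substructure T ?A) = {p. p permutes ?A \<and> evenperm p}"
    using assms card xs(3) unfolding hypertournament_def by blast
  have even: "map p ys \<in> rel T \<longleftrightarrow> ys \<in> rel T"
    if "p permutes ?A" "evenperm p" "set ys \<subseteq> ?A" for p ys
    using that Aut unfolding automorphisms_substructure by blast
  have t: "?t permutes ?A" using ab by (simp add: permutes_swap_id)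
  have "\<not> evenperm ?t" using ab(3) by (simp add: evenperm_swap)
  then have "?t \<notin> automorphisms (substructure T ?A)" using Aut by blast
  then obtain ys where ys: "set ys \<subseteq> ?A" "(ys \<in> rel T) \<noteq> (map ?t ys \<in> rel T)"
    unfolding automorphisms_substructure using t by blast
  have "distinct ys \<and> length ys = n"
    using ys(2) assms distinct_map_permutes[OF t]
    unfolding hypertournament_def nary_structure_def by (metis length_map)
  moreover from this have "set ys = ?A"
    using ys(1) card by (metis card_subset_eq distinct_card finite_set)
  ultimately obtain p where p: "p permutes ?A" "map p ys = xs"
    using ex1_permutes_map[of ys xs] xs by metis
  have perm: "permutation p" "permutation ?t"
    using p(1) t permutation_permutes by (blast intro: finite_set)+
  \<comment> \<open>For even \<open>p\<close>, \<open>p\<close> itself takes \<open>ys\<close> to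
    \<open>xs\<close> and its conjugate takes the transposed \<open>ys\<close> to the transposed
    \<open>xs\<close>. For odd \<open>p\<close>, composing with the transposition on either side
    gives even permutations that match the two pairs crosswise.\<close>
  show "(map ?t xs \<in> rel T) \<longleftrightarrow> \<not> xs \<in> rel T"
  proof (cases "evenperm p")
    case True
    define q where "q = ?t \<circ> p \<circ> ?t"
    have "q permutes ?A" "evenperm q"
      using p t perm True by (simp_all add: q_def permutes_compose evenperm_comp permutation_compose)
    moreover have "map ?t xs = map q (map ?t ys)"
      using p(2) by (auto simp: q_def)
    moreover have "set (map ?t ys) \<subseteq> ?A" using ys(1) t by (auto simp: permutes_in_image)
    ultimately show ?thesis
      using even[of q "map ?t ys"] even[of p ys] p True ys by metis
  next
    case False
    define q where "q = ?t \<circ> p"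
    define r where "r = p \<circ> ?t"
    have "q permutes ?A" "r permutes ?A" "evenperm q" "evenperm r"
      using p t perm False \<open>\<not> evenperm ?t\<close>
      by (simp_all add: q_def r_def permutes_compose evenperm_comp)
    moreover have "map ?t xs = map q ys" using p(2) by (auto simp: q_def)
    moreover have "xs = map r (map ?t ys)" using p(2) by (auto simp: r_def)
    moreover have "set (map ?t ys) \<subseteq> ?A" using ys(1) t by (auto simp: permutes_in_image)
    ultimately show ?thesis
      using even[of q ys] even[of r "map ?t ys"] ys by metis
  qed
qed

lemma hypertournament_of_alternating:
  assumes "nary_structure n T" and dist: "\<And>xs. xs \<in> rel T \<Longrightarrow> distinct xs"
    and alt: "alternating n (univ T) (\<lambda>xs. xs \<in> rel T)"
  shows "hypertournament n T"
  unfolding hypertournament_def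
proof (intro conjI ballI allI impI)
  fix A assume A: "A \<subseteq> univ T \<and> finite A \<and> card A = n"
  have map_p: "map p xs \<in> rel T \<longleftrightarrow> (xs \<in> rel T \<longleftrightarrow> evenperm p)"
    if "p permutes A" "set xs = A" "distinct xs" for p xs
    using alternating_permutes[OF alt that(3) _ _ that(1)[folded that(2)]] that A
    by (metis distinct_card)
  show "automorphisms (substructure T A) = {p. p permutes A \<and> evenperm p}"
    unfolding automorphisms_substructure
  proof (intro Collect_cong conj_cong refl, rule iffI)
    fix p assume p: "p permutes A" and iso: "\<forall>xs. set xs \<subseteq> A \<longrightarrow> (xs \<in> rel T \<longleftrightarrow> map p xs \<in> rel T)"
    obtain xs where "set xs = A" "distinct xs" using A finite_distinct_list by blast
    with map_p[OF p] iso show "evenperm p" by blast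
  next
    fix p assume p: "p permutes A" "evenperm p"
    show "\<forall>xs. set xs \<subseteq> A \<longrightarrow> (xs \<in> rel T \<longleftrightarrow> map p xs \<in> rel T)"
    proof (rule allI, rule impI)
      fix xs assume xs: "set xs \<subseteq> A"
      show "xs \<in> rel T \<longleftrightarrow> map p xs \<in> rel T"
      proof (cases "distinct xs \<and> length xs = n")
        case True
        then have "set xs = A" using xs A by (metis card_subset_eq distinct_card)
        with map_p p True show ?thesis by blast
      next
        case False
        then show ?thesis
          using assms(1) dist distinct_map_permutes[OF p(1)]
          unfolding nary_structure_def by (metis length_map)
      qed
    qed
  qed
qed (use assms in auto)

lemma map_transpose_inj_on:
  assumes "inj_on f S" "set xs \<subseteq> S" "a \<in> S" "b \<in> S"
  shows "map f (map (transpose a b) xs) = map (transpose (f a) (f b)) (map f xs)"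
proof -
  have "f (transpose a b x) = transpose (f a) (f b) (f x)" if "x \<in> set xs" for x
    using inj_on_eq_iff[OF assms(1) subsetD[OF assms(2) that]] assms(3,4) by (simp add: transpose_def)
  then show ?thesis by simp
qed

lemma alternating_map:
  assumes alt: "alternating k A \<tau>" and f: "inj_on f B" "f ` B \<subseteq> A"
  shows "alternating k B (\<lambda>xs. \<tau> (map f xs))"
  unfolding alternating_def
proof (intro allI impI, elim conjE)
  fix xs a b
  assume xs: "distinct xs" "length xs = k" "set xs \<subseteq> B" and ab: "a \<in> set xs" "b \<in> set xs" "a \<noteq> b"
  have "map f (map (transpose a b) xs) = map (transpose (f a) (f b)) (map f xs)"
    using f(1) xs(3) ab by (intro map_transpose_inj_on[of _ B]) auto
  moreover have "\<tau> (map (transpose (f a) (f b)) (map f xs)) \<longleftrightarrow> \<not> \<tau> (map f xs)"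
  proof (rule alternatingD[OF alt])
    show "distinct (map f xs)" using xs f(1) by (simp add: distinct_map inj_on_subset)
    show "f a \<noteq> f b" using inj_on_eq_iff[OF f(1)] ab xs(3) by blast
    show "length (map f xs) = k" using xs(2) by simp
    show "set (map f xs) \<subseteq> A" using xs(3) f(2) by auto
    show "f a \<in> set (map f xs)" "f b \<in> set (map f xs)" using ab by simp_all
  qed
  ultimately show "\<tau> (map f (map (transpose a b) xs)) \<longleftrightarrow> \<not> \<tau> (map f xs)" by (simp only:)
qed

lemma alternating_subset: "alternating k A \<tau> \<Longrightarrow> B \<subseteq> A \<Longrightarrow> alternating k B \<tau>"
  unfolding alternating_def by (metis subset_trans)

lemma set_map_transpose: "a \<in> set xs \<Longrightarrow> b \<in> set xs \<Longrightarrow> set (map (transpose a b) xs) = set xs"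
  by (simp add: set_map_permutes permutes_swap_id)

text \<open>Tuples through the new point \<open>e\<close> are governed by \<open>\<sigma>\<close>
  alone and tuples of old points by \<open>\<rho>\<close> alone. These are disjoint families of
  supports, so the two prescriptions never meet.\<close>

lemma ex_one_point_extension:
  assumes \<rho>: "alternating n B \<rho>" and \<sigma>: "alternating (n - 1) B \<sigma>" and "n \<ge> 1" and e: "e \<notin> B"
  shows "\<exists>Q. (\<forall>xs\<in>Q. distinct xs \<and> length xs = n \<and> set xs \<subseteq> insert e B) \<and>
      alternating n (insert e B) (\<lambda>xs. xs \<in> Q) \<and>
      (\<forall>xs. distinct xs \<and> length xs = n \<and> set xs \<subseteq> B \<longrightarrow> (xs \<in> Q \<longleftrightarrow> \<rho> xs)) \<and>
      (\<forall>ys. distinct ys \<and> length ys = n - 1 \<and> set ys \<subseteq> B \<longrightarrow> (e # ys \<in> Q \<longleftrightarrow> \<sigma> ys))"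
proof -
  obtain \<tau> :: "'a list \<Rightarrow> bool" where \<tau>: "\<And>k. alternating k UNIV \<tau>"
    using ex_alternating by blast
  define l where "l C = (SOME ys. distinct ys \<and> set ys = C - {e})" for C
  \<comment> \<open>A sign for each support: \<open>\<tau>\<close> is kept or reversed so that it
    agrees with \<open>\<sigma>\<close> on the chosen enumeration. A sign that depends only on the
    support does not disturb alternation.\<close>
  define \<kappa> where "\<kappa> C \<longleftrightarrow> (\<tau> (e # l C) \<longleftrightarrow> \<sigma> (l C))" for C
  define Q where "Q = {xs. distinct xs \<and> length xs = n \<and> set xs \<subseteq> insert e B \<and>
      (if e \<in> set xs then \<tau> xs \<longleftrightarrow> \<kappa> (set xs) else \<rho> xs)}"
  have "alternating n (insert e B) (\<lambda>xs. xs \<in> Q)"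
    unfolding alternating_def
  proof (intro allI impI, elim conjE)
    fix xs a b
    assume xs: "distinct xs" "length xs = n" "set xs \<subseteq> insert e B"
      and ab: "a \<in> set xs" "b \<in> set xs" "a \<noteq> b"
    have s: "set (map (transpose a b) xs) = set xs" using ab by (simp add: set_map_transpose)
    have d: "distinct (map (transpose a b) xs)"
      using xs(1) distinct_map_permutes[OF permutes_swap_id[OF ab(1,2)]] by blast
    have "\<tau> (map (transpose a b) xs) \<longleftrightarrow> \<not> \<tau> xs"
      using alternatingD[OF \<tau>] xs ab by blast
    moreover have "\<rho> (map (transpose a b) xs) \<longleftrightarrow> \<not> \<rho> xs" if "e \<notin> set xs"
      using alternatingD[OF \<rho> xs(1,2) _ ab] that xs(3) by blast
    ultimately show "map (transpose a b) xs \<in> Q \<longleftrightarrow> \<not> xs \<in> Q"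
      unfolding Q_def mem_Collect_eq s using xs d by (auto simp del: set_map)
  qed
  moreover have "e # ys \<in> Q \<longleftrightarrow> \<sigma> ys"
    if ys: "distinct ys" "length ys = n - 1" "set ys \<subseteq> B" for ys
  proof -
    have e_ys: "e \<notin> set ys" using ys e by blast
    let ?C = "set (e # ys)" and ?l = "l (set (e # ys))"
    have "\<exists>zs. distinct zs \<and> set zs = ?C - {e}"
      using ys e_ys by (intro exI[of _ ys]) auto
    then have "distinct ?l \<and> set ?l = ?C - {e}"
      unfolding l_def by (rule someI_ex)
    then have l: "distinct ?l" "set ?l = set ys" using e_ys by auto
    have len: "length ?l = n - 1" using l ys by (metis distinct_card)
    obtain p where p: "p permutes set ?l" "map p ?l = ys"
      using ex1_permutes_map[OF l(1) ys(1) l(2)] by blast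
    have "p e = e" using p(1) e_ys l(2) by (metis permutes_not_in)
    then have "map p (e # ?l) = e # ys" using p(2) by simp
    moreover have "p permutes set (e # ?l)"
      using p(1) by (rule permutes_subset) auto
    ultimately have "\<tau> (e # ys) \<longleftrightarrow> (\<tau> (e # ?l) \<longleftrightarrow> evenperm p)"
      using alternating_permutes[OF \<tau>, of "e # ?l" "length (e # ?l)" p] l e_ys by simp
    moreover have "\<sigma> ys \<longleftrightarrow> (\<sigma> ?l \<longleftrightarrow> evenperm p)"
      using alternating_permutes[OF \<sigma> l(1) len _ p(1)] l(2) ys(3) p(2) by simp
    ultimately show ?thesis
      using ys e_ys \<open>n \<ge> 1\<close> by (auto simp: Q_def \<kappa>_def)
  qed
  moreover have "\<forall>xs. distinct xs \<and> length xs = n \<and> set xs \<subseteq> B \<longrightarrow> (xs \<in> Q \<longleftrightarrow> \<rho> xs)"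
    using e by (auto simp: Q_def)
  ultimately show ?thesis by (intro exI[of _ Q]) (auto simp: Q_def)
qed

text \<open>What the back-and-forth construction takes from genericity. A type is given by its
  values on tuples headed by the realizing point \<open>x\<close>, since alternation determines the
  tuples with \<open>x\<close> in another position.\<close>

locale one_point_rich =
  fixes U :: "'a set" and R :: "'a list set" and n :: nat
  assumes n: "n \<ge> 3" and countable_U: "countable U"
    and R_length: "xs \<in> R \<Longrightarrow> length xs = n"
    and R_subset: "xs \<in> R \<Longrightarrow> set xs \<subseteq> U"
    and R_distinct: "xs \<in> R \<Longrightarrow> distinct xs"
    and R_alternating: "alternating n U (\<lambda>xs. xs \<in> R)"
    and ex_realization: "\<lbrakk>finite A; A \<subseteq> U; alternating (n - 1) A \<tau>\<rbrakk> \<Longrightarrow>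
      \<exists>x \<in> U - A. \<forall>ys. distinct ys \<and> length ys = n - 1 \<and> set ys \<subseteq> A \<longrightarrow> (x # ys \<in> R \<longleftrightarrow> \<tau> ys)"

text \<open>The type is realized in an abstract one-point extension of \<open>A\<close>, the
  extension is embedded in \<open>T\<close>, and ultrahomogeneity moves the embedded copy of
  \<open>A\<close> back to \<open>A\<close>. The image of the extra point is the
  realization.\<close>

lemma generic_one_point_rich:
  assumes n: "n \<ge> 3" and gen: "generic_hypertournament n T"
  shows "one_point_rich (univ T) (rel T) n"
proof -
  have nary: "nary_structure n T" and cnt: "countable (univ T)" and hom: "ultrahomogeneous T"
    and sub: "\<And>A. A \<subseteq> univ T \<Longrightarrow> finite A \<Longrightarrow> hypertournament n (substructure T A)"
    and emb: "\<And>S :: nat rel_struct. finite (univ S) \<Longrightarrow> hypertournament n S \<Longrightarrow>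
        \<exists>A f. A \<subseteq> univ T \<and> isomorphism f S (substructure T A)"
    using gen unfolding generic_hypertournament_def by blast+
  have R: "length xs = n" "set xs \<subseteq> univ T" if "xs \<in> rel T" for xs
    using nary that unfolding nary_structure_def by blast+
  have dist: "distinct xs" if "xs \<in> rel T" for xs
  proof -
    have "hypertournament n (substructure T (set xs))" using sub R(2)[OF that] by blast
    then show ?thesis using that unfolding hypertournament_def substructure_def by auto
  qed
  have alt: "alternating n (univ T) (\<lambda>xs. xs \<in> rel T)"
    unfolding alternating_def
  proof (intro allI impI, elim conjE)
    fix xs a b
    assume xs: "distinct xs" "length xs = n" "set xs \<subseteq> univ T"
      and ab: "a \<in> set xs" "b \<in> set xs" "a \<noteq> b"
    have "hypertournament n (substructure T (set xs))" using sub xs(3) by blast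
    from alternatingD[OF alternating_of_hypertournament[OF this] xs(1,2) _ ab]
    show "map (transpose a b) xs \<in> rel T \<longleftrightarrow> \<not> xs \<in> rel T"
      using set_map_transpose[OF ab(1,2)] by (simp add: substructure_def)
  qed
  have ext: "\<exists>x \<in> univ T - A. \<forall>ys. distinct ys \<and> length ys = n - 1 \<and> set ys \<subseteq> A \<longrightarrow>
      (x # ys \<in> rel T \<longleftrightarrow> \<tau> ys)"
    if A: "finite A" "A \<subseteq> univ T" and \<tau>: "alternating (n - 1) A \<tau>" for A \<tau>
  proof -
    \<comment> \<open>\<open>A\<close> is copied to an initial segment of the naturals because the
      age of \<open>T\<close> is described by structures on \<open>nat\<close>; the number
      \<open>k\<close> becomes the extra point.\<close>
    obtain \<phi> :: "'a \<Rightarrow> nat" where \<phi>: "bij_betw \<phi> A {0..<card A}"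
      using ex_bij_betw_finite_nat[OF A(1)] by blast
    define k where "k = card A"
    define \<psi> where "\<psi> = inv_into A \<phi>"
    have \<psi>: "bij_betw \<psi> {0..<k} A" using \<phi> unfolding \<psi>_def k_def by (rule bij_betw_inv_into)
    have \<psi>\<phi>: "\<psi> (\<phi> x) = x" if "x \<in> A" for x
      using \<phi> that unfolding \<psi>_def by (simp add: bij_betw_inv_into_left)
    have inj: "inj_on \<psi> {0..<k}" "\<psi> ` {0..<k} \<subseteq> A" using \<psi> by (auto simp: bij_betw_def)
    have alt\<psi>: "alternating n {0..<k} (\<lambda>xs. map \<psi> xs \<in> rel T)"
      using alternating_map[OF alternating_subset[OF alt A(2)] inj] .
    have \<tau>\<psi>: "alternating (n - 1) {0..<k} (\<lambda>xs. \<tau> (map \<psi> xs))"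
      using alternating_map[OF \<tau> inj] .
    have "1 \<le> n" "k \<notin> {0..<k}" using n by auto
    from ex_one_point_extension[OF alt\<psi> \<tau>\<psi> this]
    obtain Q where Q: "\<forall>xs\<in>Q. distinct xs \<and> length xs = n \<and> set xs \<subseteq> insert k {0..<k}"
      and Q_alt: "alternating n (insert k {0..<k}) (\<lambda>xs. xs \<in> Q)"
      and Q_old: "\<forall>xs. distinct xs \<and> length xs = n \<and> set xs \<subseteq> {0..<k} \<longrightarrow>
          (xs \<in> Q \<longleftrightarrow> map \<psi> xs \<in> rel T)"
      and Q_new: "\<forall>ys. distinct ys \<and> length ys = n - 1 \<and> set ys \<subseteq> {0..<k} \<longrightarrow>
          (k # ys \<in> Q \<longleftrightarrow> \<tau> (map \<psi> ys))"
      by (elim exE conjE) (rule that)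
    define S where "S = \<lparr>univ = insert k {0..<k}, rel = Q\<rparr>"
    have "hypertournament n S"
      by (rule hypertournament_of_alternating)
        (use Q Q_alt in \<open>auto simp: S_def nary_structure_def\<close>)
    then obtain B f where B: "B \<subseteq> univ T" and f: "isomorphism f S (substructure T B)"
      using emb[of S] by (auto simp: S_def)
    have f_bij: "bij_betw f (insert k {0..<k}) B"
      and f_rel: "\<And>xs. set xs \<subseteq> insert k {0..<k} \<Longrightarrow> xs \<in> Q \<longleftrightarrow> map f xs \<in> rel T"
    proof -
      show bij: "bij_betw f (insert k {0..<k}) B"
        using f by (simp add: isomorphism_def S_def substructure_def)
      show "xs \<in> Q \<longleftrightarrow> map f xs \<in> rel T" if "set xs \<subseteq> insert k {0..<k}" for xs
      proof -
        have "set (map f xs) \<subseteq> B" using bij that unfolding bij_betw_def by auto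
        then show ?thesis
          using f that by (auto simp: isomorphism_def S_def substructure_def)
      qed
    qed
    let ?C = "f ` {0..<k}"
    have f_inj: "inj_on f (insert k {0..<k})" using f_bij by (simp add: bij_betw_def)
    define h where "h = \<psi> \<circ> inv_into {0..<k} f"
    have h_bij: "bij_betw h ?C A"
      unfolding h_def using f_inj \<psi>
      by (intro bij_betw_trans[of _ _ "{0..<k}"] bij_betw_inv_into) (auto simp: bij_betw_def)
    have hf: "h (f i) = \<psi> i" if "i < k" for i
      unfolding h_def using f_inj that by (simp add: inv_into_f_f)
    have h_iso: "isomorphism h (substructure T ?C) (substructure T A)"
      unfolding isomorphism_def
    proof (intro conjI allI impI)
      show "bij_betw h (univ (substructure T ?C)) (univ (substructure T A))"
        using h_bij by (simp add: substructure_def)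
      fix ys assume "set ys \<subseteq> univ (substructure T ?C)"
      then have ys: "set ys \<subseteq> ?C" by (simp add: substructure_def)
      then have "\<forall>y\<in>set ys. \<exists>x. y = f x \<and> x \<in> {0..<k}" by blast
      then obtain r where r: "\<forall>y\<in>set ys. y = f (r y) \<and> r y \<in> {0..<k}" by metis
      define xs where "xs = map r ys"
      have xs: "set xs \<subseteq> {0..<k}" "ys = map f xs"
        using r by (auto simp: xs_def intro: map_idI[symmetric])
      have hys: "map h ys = map \<psi> xs" using xs hf by (auto simp: subset_iff)
      have "set (map h ys) \<subseteq> A" using ys h_bij by (auto simp: bij_betw_def)
      moreover have "ys \<in> rel T \<longleftrightarrow> map h ys \<in> rel T"
      proof (cases "distinct xs \<and> length xs = n")
        case True
        then have "xs \<in> Q \<longleftrightarrow> map \<psi> xs \<in> rel T" using Q_old xs(1) by blast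
        moreover have "xs \<in> Q \<longleftrightarrow> ys \<in> rel T"
          unfolding xs(2) by (rule f_rel) (use xs(1) in blast)
        ultimately show ?thesis unfolding hys by blast
      next
        case False
        then have "ys \<notin> rel T" using f_rel[of xs] Q xs by fastforce
        moreover have "map \<psi> xs \<notin> rel T"
          using False R(1)[of "map \<psi> xs"] dist[of "map \<psi> xs"] by (auto simp: distinct_map)
        ultimately show ?thesis unfolding hys by blast
      qed
      ultimately show "ys \<in> rel (substructure T ?C) \<longleftrightarrow> map h ys \<in> rel (substructure T A)"
        using ys by (simp add: substructure_def)
    qed
    have C: "?C \<subseteq> univ T" using B f_bij by (auto simp: bij_betw_def)
    have "\<exists>p\<in>automorphisms T. \<forall>x\<in>?C. p x = h x"
      by (rule hom[unfolded ultrahomogeneous_def, rule_format, of ?C A h])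
        (use C A h_iso in simp)
    then obtain p where p: "p \<in> automorphisms T" "\<forall>x\<in>?C. p x = h x"
      by blast
    have p_perm: "p permutes univ T"
      and p_rel: "\<And>xs. set xs \<subseteq> univ T \<Longrightarrow> xs \<in> rel T \<longleftrightarrow> map p xs \<in> rel T"
      using p(1) unfolding automorphisms_def isomorphism_def by auto
    have "f k \<in> univ T" using bij_betwE[OF f_bij] B by blast
    moreover have "f k \<notin> ?C"
      using inj_on_image_mem_iff[OF f_inj, of k "{0..<k}"] by (simp add: subset_insertI)
    ultimately have fk: "f k \<in> univ T" "f k \<notin> ?C" .
    have "p ` ?C = h ` ?C" using p(2) by (intro image_cong) auto
    then have pC: "p ` ?C = A" using h_bij by (simp add: bij_betw_def)
    have "p (f k) \<notin> A"
      using fk(2) inj_image_mem_iff[OF permutes_inj[OF p_perm]] unfolding pC[symmetric] by blast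
    then have "p (f k) \<in> univ T - A"
      using fk(1) permutes_in_image[OF p_perm] by blast
    moreover have "p (f k) # ys \<in> rel T \<longleftrightarrow> \<tau> ys"
      if ys: "distinct ys" "length ys = n - 1" "set ys \<subseteq> A" for ys
    proof -
      let ?zs = "map \<phi> ys"
      have zs: "set ?zs \<subseteq> {0..<k}" using ys(3) bij_betwE[OF \<phi>] by (auto simp: k_def)
      have "distinct ?zs"
        using ys(1) inj_on_subset[OF bij_betw_imp_inj_on[OF \<phi>] ys(3)] by (simp add: distinct_map)
      moreover have \<psi>zs: "map \<psi> ?zs = ys" unfolding map_map using ys(3) \<psi>\<phi> by (intro map_idI) auto
      ultimately have "k # ?zs \<in> Q \<longleftrightarrow> \<tau> ys"
        using Q_new[rule_format, of ?zs] zs ys(2) by simp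
      moreover have "k # ?zs \<in> Q \<longleftrightarrow> f k # map f ?zs \<in> rel T"
        using f_rel[of "k # ?zs"] zs by auto
      moreover have "map p (map f ?zs) = map \<psi> ?zs"
      proof -
        have "map (p \<circ> f) ?zs = map \<psi> ?zs"
        proof (rule map_cong[OF refl])
          fix i assume "i \<in> set ?zs"
          then have "i < k" using zs by auto
          then show "(p \<circ> f) i = \<psi> i" using p(2) hf by auto
        qed
        then show ?thesis by (simp only: map_map comp_assoc)
      qed
      then have "map p (f k # map f ?zs) = p (f k) # ys" using \<psi>zs by (simp only: list.map)
      moreover have "set (f k # map f ?zs) \<subseteq> univ T"
        using fk(1) C zs by auto
      ultimately show ?thesis using p_rel[of "f k # map f ?zs"] by argo
    qed
    ultimately show ?thesis by blast
  qed
  show ?thesis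
    by unfold_locales (fact n cnt R dist alt ext)+
qed

section \<open>Finite partial isomorphisms\<close>

text \<open>Alternation compares only tuples with the same support. So a predicate defined by cases
  on \<open>set ys\<close> may be checked against a different alternating predicate on each
  support.\<close>

lemma alternating_local:
  assumes "\<And>xs. distinct xs \<Longrightarrow> length xs = k \<Longrightarrow> set xs \<subseteq> A \<Longrightarrow>
      \<exists>\<sigma>. alternating k (set xs) \<sigma> \<and> (\<forall>ys. set ys = set xs \<longrightarrow> (\<tau> ys \<longleftrightarrow> \<sigma> ys))"
  shows "alternating k A \<tau>"
  unfolding alternating_def
proof (intro allI impI, elim conjE)
  fix xs a b
  assume xs: "distinct xs" "length xs = k" "set xs \<subseteq> A" and ab: "a \<in> set xs" "b \<in> set xs" "a \<noteq> b"
  obtain \<sigma> where \<sigma>: "alternating k (set xs) \<sigma>" "\<And>ys. set ys = set xs \<Longrightarrow> \<tau> ys \<longleftrightarrow> \<sigma> ys"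
    using assms[OF xs] by blast
  show "\<tau> (map (transpose a b) xs) \<longleftrightarrow> \<not> \<tau> xs"
    using alternatingD[OF \<sigma>(1) xs(1,2) order_refl ab] \<sigma>(2) set_map_transpose[OF ab(1,2)] by blast
qed

abbreviation finv :: "('a \<Rightarrow> 'b) \<Rightarrow> 'b \<Rightarrow> 'a" where
  "finv f \<equiv> inv_into UNIV f"

context one_point_rich
begin

definition aut :: "('a \<Rightarrow> 'a) \<Rightarrow> bool" where
  "aut f \<longleftrightarrow> f permutes U \<and> (\<forall>xs. set xs \<subseteq> U \<longrightarrow> (map f xs \<in> R \<longleftrightarrow> xs \<in> R))"

lemma aut_permutes: "aut f \<Longrightarrow> f permutes U"
  by (simp add: aut_def)

lemma aut_in_iff: "aut f \<Longrightarrow> f x \<in> U \<longleftrightarrow> x \<in> U"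
  by (simp add: aut_permutes permutes_in_image)

lemma aut_rel: "aut f \<Longrightarrow> set xs \<subseteq> U \<Longrightarrow> map f xs \<in> R \<longleftrightarrow> xs \<in> R"
  by (simp add: aut_def)

lemma aut_inv: assumes "aut f" shows "aut (finv f)"
  unfolding aut_def
proof (intro conjI allI impI)
  note perm = aut_permutes[OF assms]
  show inv: "finv f permutes U" using permutes_inv[OF perm] .
  fix xs assume xs: "set xs \<subseteq> U"
  then have "set (map (finv f) xs) \<subseteq> U" using inv by (auto simp: permutes_in_image)
  from aut_rel[OF assms this] show "map (finv f) xs \<in> R \<longleftrightarrow> xs \<in> R"
    using permutes_inverses(1)[OF perm] by (simp add: comp_def)
qed

lemma aut_inv_apply [simp]: "aut f \<Longrightarrow> finv f (f x) = x" "aut f \<Longrightarrow> f (finv f x) = x"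
  using aut_permutes permutes_inverses by metis+

lemma aut_eq_iff [simp]: "aut f \<Longrightarrow> f x = f y \<longleftrightarrow> x = y"
  using aut_inv_apply(1) by metis

lemma aut_inv_inv: "aut f \<Longrightarrow> finv (finv f) = f"
  using aut_permutes permutes_inv_inv by blast

lemma aut_comp: assumes "aut f" "aut g" shows "aut (f \<circ> g)"
  unfolding aut_def
proof (intro conjI allI impI)
  show "f \<circ> g permutes U" using assms permutes_compose aut_permutes by blast
  fix xs assume xs: "set xs \<subseteq> U"
  then have "set (map g xs) \<subseteq> U" using aut_in_iff[OF assms(2)] by auto
  from aut_rel[OF assms(1) this] aut_rel[OF assms(2) xs]
  show "map (f \<circ> g) xs \<in> R \<longleftrightarrow> xs \<in> R" by (simp add: comp_def)
qed

lemma aut_id: "aut id"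
  by (simp add: aut_def permutes_id)

lemma infinite_U: "infinite U"
proof
  obtain \<tau> :: "'a list \<Rightarrow> bool" where \<tau>: "\<And>k. alternating k UNIV \<tau>"
    using ex_alternating by blast
  assume "finite U"
  from ex_realization[OF this order_refl alternating_subset[OF \<tau> subset_UNIV]]
  show False by blast
qed

lemma alternating_Cons: "b \<in> U \<Longrightarrow> alternating (n - 1) (U - {b}) (\<lambda>ys. b # ys \<in> R)"
  unfolding alternating_def
proof (intro allI impI, elim conjE)
  fix ys c d
  assume b: "b \<in> U" and ys: "distinct ys" "length ys = n - 1" "set ys \<subseteq> U - {b}"
    and cd: "c \<in> set ys" "d \<in> set ys" "c \<noteq> d"
  have "map (transpose c d) (b # ys) \<in> R \<longleftrightarrow> \<not> b # ys \<in> R"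
    by (rule alternatingD[OF R_alternating]) (use b ys cd n in auto)
  moreover have "transpose c d b = b"
    using ys(3) cd by (intro transpose_apply_other) auto
  ultimately show "b # map (transpose c d) ys \<in> R \<longleftrightarrow> \<not> b # ys \<in> R" by simp
qed

text \<open>A set of pairs rather than a function, so that inverses are converses, limits are
  unions, and domain and range are treated alike. The middle condition makes it the graph of an
  injective map.\<close>

definition partial_iso :: "('a \<times> 'a) set \<Rightarrow> bool" where
  "partial_iso E \<longleftrightarrow> E \<subseteq> U \<times> U \<and> (\<forall>p\<in>E. \<forall>q\<in>E. fst p = fst q \<longleftrightarrow> snd p = snd q) \<and>
     (\<forall>ps. set ps \<subseteq> E \<longrightarrow> (map fst ps \<in> R \<longleftrightarrow> map snd ps \<in> R))"

lemma partial_isoD: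
  assumes "partial_iso E"
  shows "(u, x) \<in> E \<Longrightarrow> u \<in> U" "(u, x) \<in> E \<Longrightarrow> x \<in> U"
    "(u, x) \<in> E \<Longrightarrow> (v, y) \<in> E \<Longrightarrow> u = v \<longleftrightarrow> x = y"
    "set ps \<subseteq> E \<Longrightarrow> map fst ps \<in> R \<longleftrightarrow> map snd ps \<in> R"
proof -
  show "(u, x) \<in> E \<Longrightarrow> u \<in> U" "(u, x) \<in> E \<Longrightarrow> x \<in> U" using assms by (auto simp: partial_iso_def)
  show "u = v \<longleftrightarrow> x = y" if "(u, x) \<in> E" "(v, y) \<in> E"
  proof -
    have "\<forall>p\<in>E. \<forall>q\<in>E. fst p = fst q \<longleftrightarrow> snd p = snd q" using assms by (simp add: partial_iso_def)
    from this[rule_format, OF that] show ?thesis by simp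
  qed
  show "set ps \<subseteq> E \<Longrightarrow> map fst ps \<in> R \<longleftrightarrow> map snd ps \<in> R" using assms by (simp add: partial_iso_def)
qed

lemma partial_iso_empty: "partial_iso {}"
  by (simp add: partial_iso_def)

lemma partial_iso_converse: assumes "partial_iso E" shows "partial_iso (E\<inverse>)"
  unfolding partial_iso_def
proof (intro conjI allI impI)
  show "E\<inverse> \<subseteq> U \<times> U" using partial_isoD(1,2)[OF assms] by auto
  show "\<forall>p\<in>E\<inverse>. \<forall>q\<in>E\<inverse>. fst p = fst q \<longleftrightarrow> snd p = snd q"
    using partial_isoD(3)[OF assms] by fastforce
  fix ps assume "set ps \<subseteq> E\<inverse>"
  then have "set (map prod.swap ps) \<subseteq> E" by auto
  from partial_isoD(4)[OF assms this] show "map fst ps \<in> R \<longleftrightarrow> map snd ps \<in> R" by (simp add: comp_def)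
qed

lemma partial_iso_converse_iff [simp]: "partial_iso (E\<inverse>) \<longleftrightarrow> partial_iso E"
  using partial_iso_converse[of E] partial_iso_converse[of "E\<inverse>"] by auto

lemma partial_iso_aut_snd:
  assumes "partial_iso E" "aut f" shows "partial_iso ((\<lambda>(u, x). (u, f x)) ` E)"
  unfolding partial_iso_def
proof (intro conjI allI impI)
  let ?h = "\<lambda>(u, x). (u, f x)"
  show "?h ` E \<subseteq> U \<times> U" using partial_isoD(1,2)[OF assms(1)] aut_in_iff[OF assms(2)] by auto
  show "\<forall>p\<in>?h ` E. \<forall>q\<in>?h ` E. fst p = fst q \<longleftrightarrow> snd p = snd q"
    using partial_isoD(3)[OF assms(1)] assms(2) by fastforce
  fix ps assume ps: "set ps \<subseteq> ?h ` E"
  define qs where "qs = map (\<lambda>(u, x). (u, finv f x)) ps"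
  have qs: "set qs \<subseteq> E" using ps assms(2) by (auto simp: qs_def)
  have "set (map snd qs) \<subseteq> U" using qs partial_isoD(2)[OF assms(1)] by auto
  from aut_rel[OF assms(2) this] partial_isoD(4)[OF assms(1) qs]
  have "map f (map snd qs) \<in> R \<longleftrightarrow> map fst qs \<in> R" by simp
  moreover have "map f (map snd qs) = map snd ps" "map fst qs = map fst ps"
    using assms(2) by (auto simp: qs_def)
  ultimately show "map fst ps \<in> R \<longleftrightarrow> map snd ps \<in> R" by simp
qed

text \<open>Alternation on both sides allows the new point to be moved to the head, so only tuples
  headed by it have to be compared.\<close>

lemma partial_iso_insert:
  assumes E: "partial_iso E" and u: "u \<in> U" "u \<notin> Domain E" and x: "x \<in> U" "x \<notin> Range E"
    and type_eq: "\<And>ps. \<lbrakk>set ps \<subseteq> E; distinct (map fst ps); length ps = n - 1\<rbrakk> \<Longrightarrow>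
        u # map fst ps \<in> R \<longleftrightarrow> x # map snd ps \<in> R"
  shows "partial_iso (insert (u, x) E)"
  unfolding partial_iso_def
proof (intro conjI allI impI)
  let ?E = "insert (u, x) E"
  show "?E \<subseteq> U \<times> U" using partial_isoD(1,2)[OF E] u x by auto
  show inj: "\<forall>p\<in>?E. \<forall>q\<in>?E. fst p = fst q \<longleftrightarrow> snd p = snd q"
    using partial_isoD(3)[OF E] u x by fastforce
  have inj_fst: "inj_on fst ?E"
    by (rule inj_onI, rule prod_eqI) (use inj in blast)+
  have inj_snd: "inj_on snd ?E"
    by (rule inj_onI, rule prod_eqI) (use inj in blast)+
  fix ps assume ps: "set ps \<subseteq> ?E"
  show "map fst ps \<in> R \<longleftrightarrow> map snd ps \<in> R"
  proof (cases "distinct ps \<and> length ps = n")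
    case False
    have "distinct (map fst ps) \<longleftrightarrow> distinct ps" "distinct (map snd ps) \<longleftrightarrow> distinct ps"
      using inj_on_subset[OF inj_fst ps] inj_on_subset[OF inj_snd ps] by (simp_all add: distinct_map)
    then show ?thesis using False R_length R_distinct by (metis length_map)
  next
    case ps': True
    show ?thesis
    proof (cases "(u, x) \<in> set ps")
      case False
      then show ?thesis using ps partial_isoD(4)[OF E] by blast
    next
      case True
      define h where "h = hd ps"
      \<comment> \<open>The new pair trades places with the first entry \<open>h\<close> of
        \<open>ps\<close>. If the two differ, this reverses membership in \<open>R\<close> for both
        coordinate tuples, so their equivalence is unaffected.\<close>
      define qs where "qs = map (transpose h (u, x)) ps"
      have h: "h \<in> set ps" using True by (cases ps) (auto simp: h_def)
      have dq: "distinct qs"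
        unfolding qs_def using ps' distinct_map_permutes[OF permutes_swap_id[OF h True]] by simp
      have sq: "set qs = set ps" unfolding qs_def by (rule set_map_transpose[OF h True])
      have "qs \<noteq> []" using True by (auto simp: qs_def)
      moreover have "hd qs = (u, x)" using True by (cases ps) (auto simp: qs_def h_def)
      ultimately obtain rs where rs: "qs = (u, x) # rs" by (cases qs) auto
      have rsE: "set rs \<subseteq> E" using dq sq ps rs by auto
      have "distinct (map fst rs)"
        using dq rs inj_on_subset[OF inj_fst, of "set rs"] rsE by (auto simp: distinct_map)
      moreover have "length rs = n - 1"
        using ps' rs by (metis length_map length_tl list.sel(3) qs_def)
      ultimately have q: "map fst qs \<in> R \<longleftrightarrow> map snd qs \<in> R"
        using type_eq[OF rsE] rs by simp
      show ?thesis
      proof (cases "h = (u, x)")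
        case True
        then have "qs = ps" by (simp add: qs_def)
        then show ?thesis using q by simp
      next
        case False
        have hE: "h \<in> ?E" "(u, x) \<in> ?E" using h ps by auto
        have flip: "map f qs \<in> R \<longleftrightarrow> \<not> map f ps \<in> R"
          if f: "inj_on f ?E" "f ` ?E \<subseteq> U" for f
        proof -
          have "map f qs = map (transpose (f h) (f (u, x))) (map f ps)"
            unfolding qs_def by (rule map_transpose_inj_on[OF f(1) ps hE])
          moreover have "map (transpose (f h) (f (u, x))) (map f ps) \<in> R \<longleftrightarrow> \<not> map f ps \<in> R"
          proof (rule alternatingD[OF R_alternating])
            show "distinct (map f ps)" using ps' inj_on_subset[OF f(1) ps] by (simp add: distinct_map)
            show "f h \<noteq> f (u, x)" using False hE f(1) by (meson inj_onD)
          qed (use ps' ps f(2) h True in auto)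
          ultimately show ?thesis by (simp only:)
        qed
        have "fst ` ?E \<subseteq> U" "snd ` ?E \<subseteq> U"
          using partial_isoD(1,2)[OF E] u x by auto
        then show ?thesis using flip[OF inj_fst] flip[OF inj_snd] q by blast
      qed
    qed
  qed
qed

section \<open>One-point extensions with prescribed types\<close>

lemma partial_iso_alternating:
  assumes E: "partial_iso E" and b: "b \<in> U" "b \<notin> Range E"
  shows "alternating (n - 1) (Domain E) (\<lambda>ys. b # map (\<lambda>u. THE x. (u, x) \<in> E) ys \<in> R)"
proof -
  let ?e = "\<lambda>u. THE x. (u, x) \<in> E"
  have e: "(u, ?e u) \<in> E" if "u \<in> Domain E" for u
  proof -
    from that obtain x where x: "(u, x) \<in> E" by blast
    show ?thesis
      by (rule theI, rule x) (use partial_isoD(3)[OF E x] in blast)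
  qed
  show ?thesis
  proof (rule alternating_map[OF alternating_Cons[OF b(1)]])
    show "inj_on ?e (Domain E)"
    proof (rule inj_onI)
      fix u v assume "u \<in> Domain E" "v \<in> Domain E" "?e u = ?e v"
      then show "u = v" using partial_isoD(3)[OF E e e, of u v] by blast
    qed
    show "?e ` Domain E \<subseteq> U - {b}"
    proof
      fix x assume "x \<in> ?e ` Domain E"
      then obtain u where "u \<in> Domain E" "x = ?e u" by (rule imageE)
      then have "(u, x) \<in> E" using e by (simp only:)
      then show "x \<in> U - {b}" using b(2) partial_isoD(2)[OF E] by blast
    qed
  qed
qed

text \<open>\<open>z\<close> has to realize the type of \<open>b1\<close> pulled back along
  \<open>E1\<close> and that of \<open>b2\<close> pulled back along \<open>E2\<close>. These can
  conflict only on supports inside both domains, which \<open>agree\<close> excludes; each triple in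
  \<open>L\<close> is a common point \<open>y\<close> with its two images.\<close>

lemma ex_amalgam:
  assumes E1: "partial_iso E1" "finite E1" and E2: "partial_iso E2" "finite E2"
    and b1: "b1 \<in> U" "b1 \<notin> Range E1" and b2: "b2 \<in> U" "b2 \<notin> Range E2" and F: "finite F"
    and agree: "\<And>L. (\<And>y s1 s2. (y, s1, s2) \<in> set L \<Longrightarrow> (y, s1) \<in> E1 \<and> (y, s2) \<in> E2) \<Longrightarrow>
      b1 # map (fst \<circ> snd) L \<in> R \<longleftrightarrow> b2 # map (snd \<circ> snd) L \<in> R"
  shows "\<exists>z\<in>U - F. z \<notin> Domain E1 \<and> z \<notin> Domain E2 \<and>
    partial_iso (insert (z, b1) E1) \<and> partial_iso (insert (z, b2) E2)"
proof -
  obtain \<tau>0 :: "'a list \<Rightarrow> bool" where \<tau>0: "\<And>k. alternating k UNIV \<tau>0"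
    using ex_alternating by blast
  define e where "e E u = (THE x. (u, x) \<in> E)" for E :: "('a \<times> 'a) set" and u
  have e: "e E u = x" if "partial_iso E" "(u, x) \<in> E" for E u x
    unfolding e_def by (rule the_equality, rule that(2)) (use partial_isoD(3)[OF that] in blast)
  have alt1: "alternating (n - 1) (Domain E1) (\<lambda>ys. b1 # map (e E1) ys \<in> R)"
    unfolding e_def by (rule partial_iso_alternating[OF E1(1) b1])
  have alt2: "alternating (n - 1) (Domain E2) (\<lambda>ys. b2 # map (e E2) ys \<in> R)"
    unfolding e_def by (rule partial_iso_alternating[OF E2(1) b2])
  \<comment> \<open>On supports inside both domains the first clause wins, harmlessly by
    \<open>agree\<close>. Supports inside neither are oriented by the default
    \<open>\<tau>0\<close>.\<close>
  define \<tau> where "\<tau> ys \<longleftrightarrow>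
      (if set ys \<subseteq> Domain E1 then b1 # map (e E1) ys \<in> R
       else if set ys \<subseteq> Domain E2 then b2 # map (e E2) ys \<in> R
       else \<tau>0 ys)" for ys
  define A where "A = Domain E1 \<union> Domain E2 \<union> (F \<inter> U)"
  have A: "finite A" "A \<subseteq> U"
    using E1 E2 F partial_isoD(1) unfolding A_def by (auto simp: finite_Domain)
  have "alternating (n - 1) A \<tau>"
  proof (rule alternating_local)
    fix xs :: "'a list"
    consider "set xs \<subseteq> Domain E1" | "\<not> set xs \<subseteq> Domain E1" "set xs \<subseteq> Domain E2"
      | "\<not> set xs \<subseteq> Domain E1" "\<not> set xs \<subseteq> Domain E2" by blast
    then show "\<exists>\<sigma>. alternating (n - 1) (set xs) \<sigma> \<and> (\<forall>ys. set ys = set xs \<longrightarrow> (\<tau> ys \<longleftrightarrow> \<sigma> ys))"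
    proof cases
      case 1
      then show ?thesis using alternating_subset[OF alt1 1] unfolding \<tau>_def by auto
    next
      case 2
      then show ?thesis using alternating_subset[OF alt2 2(2)] unfolding \<tau>_def by auto
    next
      case 3
      then show ?thesis using alternating_subset[OF \<tau>0 subset_UNIV] unfolding \<tau>_def by auto
    qed
  qed
  from ex_realization[OF A this] obtain z where z: "z \<in> U - A"
    and z_typ: "\<And>ys. distinct ys \<Longrightarrow> length ys = n - 1 \<Longrightarrow> set ys \<subseteq> A \<Longrightarrow> z # ys \<in> R \<longleftrightarrow> \<tau> ys"
    by blast
  have map_e: "map (e E) (map fst ps) = map snd ps" if "partial_iso E" "set ps \<subseteq> E" for E ps
    using e[OF that(1)] that(2) by (auto simp: subset_iff)
  have "partial_iso (insert (z, b1) E1)"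
  proof (rule partial_iso_insert[OF E1(1) _ _ b1])
    fix ps assume ps: "set ps \<subseteq> E1" "distinct (map fst ps)" "length ps = n - 1"
    have d: "set (map fst ps) \<subseteq> Domain E1" using ps(1) by (auto simp: Domain_fst)
    have "z # map fst ps \<in> R \<longleftrightarrow> \<tau> (map fst ps)"
      by (rule z_typ) (use ps(2,3) d in \<open>auto simp: A_def\<close>)
    then show "z # map fst ps \<in> R \<longleftrightarrow> b1 # map snd ps \<in> R"
      by (simp only: \<tau>_def d if_True map_e[OF E1(1) ps(1)])
  qed (use z in \<open>auto simp: A_def\<close>)
  moreover have "partial_iso (insert (z, b2) E2)"
  proof (rule partial_iso_insert[OF E2(1) _ _ b2])
    fix ps assume ps: "set ps \<subseteq> E2" "distinct (map fst ps)" "length ps = n - 1"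
    have d2: "set (map fst ps) \<subseteq> Domain E2" using ps(1) by (auto simp: Domain_fst)
    have z2: "z # map fst ps \<in> R \<longleftrightarrow> \<tau> (map fst ps)"
      by (rule z_typ) (use ps(2,3) d2 in \<open>auto simp: A_def\<close>)
    show "z # map fst ps \<in> R \<longleftrightarrow> b2 # map snd ps \<in> R"
    proof (cases "set (map fst ps) \<subseteq> Domain E1")
      case False
      then show ?thesis using z2 by (simp only: \<tau>_def d2 if_True if_False map_e[OF E2(1) ps(1)])
    next
      case True
      define L where "L = map (\<lambda>(y, s). (y, e E1 y, s)) ps"
      have "(y, s1) \<in> E1 \<and> (y, s2) \<in> E2" if "(y, s1, s2) \<in> set L" for y s1 s2
      proof -
        have ys: "(y, s2) \<in> set ps" "s1 = e E1 y" using that by (auto simp: L_def)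
        then obtain s where "(y, s) \<in> E1" using True by force
        then show ?thesis using e[OF E1(1)] ys ps(1) by auto
      qed
      from agree[OF this] have "b1 # map (fst \<circ> snd) L \<in> R \<longleftrightarrow> b2 # map (snd \<circ> snd) L \<in> R" .
      moreover have "map (fst \<circ> snd) L = map (e E1) (map fst ps)" "map (snd \<circ> snd) L = map snd ps"
        by (auto simp: L_def)
      ultimately show ?thesis using z2 by (simp only: \<tau>_def True if_True)
    qed
  qed (use z in \<open>auto simp: A_def\<close>)
  ultimately show ?thesis using z by (auto simp: A_def)
qed

text \<open>The case of two equal partial isomorphisms in \<open>ex_amalgam\<close>, applied to the
  converse: the two prescribed types coincide.\<close>

lemma ex_extension_range:
  assumes "partial_iso E" "finite E" "u \<in> U" "u \<notin> Domain E" "finite F"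
  shows "\<exists>x\<in>U - F. x \<notin> Range E \<and> partial_iso (insert (u, x) E)"
proof -
  have "\<exists>x\<in>U - F. x \<notin> Domain (E\<inverse>) \<and> x \<notin> Domain (E\<inverse>) \<and>
    partial_iso (insert (x, u) (E\<inverse>)) \<and> partial_iso (insert (x, u) (E\<inverse>))"
  proof (rule ex_amalgam)
    fix L assume "\<And>y s1 s2. (y, s1, s2) \<in> set L \<Longrightarrow> (y, s1) \<in> E\<inverse> \<and> (y, s2) \<in> E\<inverse>"
    then have "s1 = s2" if "(y, s1, s2) \<in> set L" for y s1 s2
      using partial_isoD(3)[OF assms(1), of s1 y s2 y] that by auto
    then have "map (fst \<circ> snd) L = map (snd \<circ> snd) L" by (intro map_cong) auto
    then show "u # map (fst \<circ> snd) L \<in> R \<longleftrightarrow> u # map (snd \<circ> snd) L \<in> R" by (simp only:)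
  qed (use assms in auto)
  then obtain x where x: "x \<in> U - F" "x \<notin> Range E" "partial_iso (insert (x, u) (E\<inverse>))" by auto
  have "insert (x, u) (E\<inverse>) = (insert (u, x) E)\<inverse>" by auto
  with x show ?thesis using partial_iso_converse_iff by metis
qed

text \<open>
  The \<open>g\<close>-image of \<open>u\<close> differs from \<open>u\<close> as soon as \<open>u\<close> induces different orientations on a
  tuple and on its \<open>g\<close>-image. Since \<open>n \<ge> 3\<close>, such a tuple can be chosen to start with a
  moved point and to leave any given finite set, so this requirement is compatible with
  every type over that set.
\<close>

lemma ex_moved_extension:
  assumes E: "partial_iso E" "finite E" and x: "x \<in> U" "x \<notin> Range E" and F: "finite F"
    and g: "aut g" "g \<noteq> id"
  shows "\<exists>u\<in>U - F. u \<notin> Domain E \<and> g u \<noteq> u \<and> g u \<notin> F \<and> finv g u \<notin> F \<and> partial_iso (insert (u, x) E)"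
proof -
  obtain t where t: "t \<in> U" "g t \<noteq> t"
    using g aut_permutes[OF g(1)] by (metis eq_id_iff permutes_not_in)
  \<comment> \<open>The \<open>n - 2\<close> further entries of the test tuple avoid
    \<open>Domain E\<close>. At least one is needed, as \<open>t\<close> itself may lie in
    \<open>Domain E\<close>, where the type is prescribed. Excluding \<open>g t\<close> makes the
    supports of \<open>s\<close> and \<open>map g s\<close> differ.\<close>
  have "infinite (U - (Domain E \<union> {t, g t}))"
    using infinite_U E(2) by (simp add: finite_Domain)
  then obtain C where C: "C \<subseteq> U - (Domain E \<union> {t, g t})" "finite C" "card C = n - 2"
    by (meson infinite_arbitrarily_large)
  then obtain cs where cs: "set cs = C" "distinct cs" using finite_distinct_list by blast
  define s where "s = t # cs"
  have "length cs = n - 2" using C(3) cs by (metis distinct_card)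
  then have s: "distinct s" "length s = n - 1" "set s \<subseteq> U" "g t \<notin> set s"
    using C(1) cs t n by (auto simp: s_def)
  have "C \<noteq> {}" using C(3) n by auto
  then obtain c where "c \<in> C" by blast
  then have "c \<in> set s" "c \<notin> Domain E" using C(1) cs by (auto simp: s_def)
  then have s_E: "\<not> set s \<subseteq> Domain E" by blast
  have gs: "set (map g s) \<noteq> set s" using s(4) by (auto simp: s_def)
  obtain \<tau>0 :: "'a list \<Rightarrow> bool" where \<tau>0: "\<And>k. alternating k UNIV \<tau>0"
    using ex_alternating by blast
  define e where "e u = (THE x. (u, x) \<in> E)" for u
  have e: "e u = x" if "(u, x) \<in> E" for u x
    unfolding e_def by (rule the_equality, rule that) (use partial_isoD(3)[OF E(1) that] in blast)
  have alt1: "alternating (n - 1) (Domain E) (\<lambda>ys. x # map e ys \<in> R)"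
    unfolding e_def by (rule partial_iso_alternating[OF E(1) x])
  define \<tau>2 where "\<tau>2 ys \<longleftrightarrow> (if set ys \<subseteq> Domain E then x # map e ys \<in> R else \<tau>0 ys)" for ys
  \<comment> \<open>Reverses the orientation on the support of \<open>s\<close> just when
    \<open>s\<close> and its image would otherwise be oriented alike. The image has another support
    and is not affected.\<close>
  define \<tau> where "\<tau> ys \<longleftrightarrow> \<tau>2 ys \<noteq> (set ys = set s \<and> \<tau>2 s = \<tau>2 (map g s))" for ys
  \<comment> \<open>The translates of \<open>F\<close> under \<open>g\<close> and its inverse are
    included so that \<open>g u\<close> and \<open>finv g u\<close> avoid \<open>F\<close> as
    well.\<close>
  define A where "A = Domain E \<union> ((F \<union> g ` F \<union> finv g ` F) \<inter> U) \<union> set s \<union> set (map g s)"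
  have A: "finite A" "A \<subseteq> U"
    using E F s(3) aut_in_iff[OF g(1)] partial_isoD(1) unfolding A_def by (auto simp: finite_Domain)
  have "alternating (n - 1) A \<tau>"
  proof (rule alternating_local)
    fix xs :: "'a list"
    define b where "b \<longleftrightarrow> set xs = set s \<and> \<tau>2 s = \<tau>2 (map g s)"
    define \<tau>3 where "\<tau>3 = (if set xs \<subseteq> Domain E then \<lambda>ys. x # map e ys \<in> R else \<tau>0)"
    have "alternating (n - 1) (set xs) \<tau>3"
      unfolding \<tau>3_def using alternating_subset[OF alt1] alternating_subset[OF \<tau>0 subset_UNIV] by auto
    then have "alternating (n - 1) (set xs) (\<lambda>ys. \<tau>3 ys \<noteq> b)"
      unfolding alternating_def by blast
    moreover have "\<tau> ys \<longleftrightarrow> \<tau>3 ys \<noteq> b" if "set ys = set xs" for ys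
      using that by (auto simp: \<tau>_def \<tau>2_def \<tau>3_def b_def)
    ultimately show "\<exists>\<sigma>. alternating (n - 1) (set xs) \<sigma> \<and> (\<forall>ys. set ys = set xs \<longrightarrow> (\<tau> ys \<longleftrightarrow> \<sigma> ys))"
      by blast
  qed
  from ex_realization[OF A this] obtain u where u: "u \<in> U - A"
    and u_typ: "\<And>ys. distinct ys \<Longrightarrow> length ys = n - 1 \<Longrightarrow> set ys \<subseteq> A \<Longrightarrow> u # ys \<in> R \<longleftrightarrow> \<tau> ys"
    by blast
  have "partial_iso (insert (u, x) E)"
  proof (rule partial_iso_insert[OF E(1) _ _ x])
    fix ps assume ps: "set ps \<subseteq> E" "distinct (map fst ps)" "length ps = n - 1"
    have d: "set (map fst ps) \<subseteq> Domain E" using ps(1) by (auto simp: Domain_fst)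
    then have ne: "set (map fst ps) \<noteq> set s" using s_E by metis
    have map_e: "map e (map fst ps) = map snd ps" using e ps(1) by (auto simp: subset_iff)
    have "u # map fst ps \<in> R \<longleftrightarrow> \<tau> (map fst ps)"
      by (rule u_typ) (use ps d in \<open>auto simp: A_def\<close>)
    then show "u # map fst ps \<in> R \<longleftrightarrow> x # map snd ps \<in> R"
      by (simp only: \<tau>_def \<tau>2_def d ne map_e if_True simp_thms)
  qed (use u in \<open>auto simp: A_def\<close>)
  moreover have "g u \<noteq> u"
  proof
    assume gu: "g u = u"
    have "u # s \<in> R \<longleftrightarrow> \<tau> s" by (rule u_typ) (use s in \<open>auto simp: A_def\<close>)
    moreover have "u # map g s \<in> R \<longleftrightarrow> \<tau> (map g s)"
      by (rule u_typ) (use s g in \<open>auto simp: A_def distinct_map inj_on_def\<close>)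
    moreover have "map g (u # s) \<in> R \<longleftrightarrow> u # s \<in> R"
      by (rule aut_rel[OF g(1)]) (use u s in auto)
    ultimately have "\<tau> s \<longleftrightarrow> \<tau> (map g s)" using gu by simp
    then show False using gs unfolding \<tau>_def by blast
  qed
  moreover have "u \<notin> F" using u by (auto simp: A_def)
  moreover have "g u \<notin> F"
  proof
    assume "g u \<in> F"
    then have "finv g (g u) \<in> finv g ` F" by (rule imageI)
    then show False using u g(1) by (auto simp: A_def)
  qed
  moreover have "finv g u \<notin> F"
  proof
    assume "finv g u \<in> F"
    then have "g (finv g u) \<in> g ` F" by (rule imageI)
    then show False using u g(1) by (auto simp: A_def)
  qed
  ultimately show ?thesis using u by (auto simp: A_def)
qed

end

section \<open>Hexagons\<close>

text \<open>Edges and corners are indexed modulo 6. Arguments are made relative to a current corner,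
  hence the enumeration from an arbitrary \<open>k\<close>.\<close>

lemma UNIV_6: "(UNIV :: 6 set) = {k, k + 1, k + 2, k + 3, k + 4, k + 5}"
proof -
  have "card {k, k + 1, k + 2, k + 3, k + 4, k + 5} = CARD(6)" by simp
  then have "{k, k + 1, k + 2, k + 3, k + 4, k + 5} = UNIV"
    by (intro card_subset_eq) simp_all
  then show ?thesis by simp
qed

lemma all_6: "(\<forall>c::6. P c) \<longleftrightarrow> P k \<and> P (k + 1) \<and> P (k + 2) \<and> P (k + 3) \<and> P (k + 4) \<and> P (k + 5)"
proof -
  have "(\<forall>c::6. P c) \<longleftrightarrow> (\<forall>c\<in>UNIV. P c)" by simp
  then show ?thesis unfolding UNIV_6[of k] by simp
qed

lemma add_6: "(k::6) + 1 + 1 = k + 2" "(k::6) + 2 + 1 = k + 3" "(k::6) + 3 + 1 = k + 4"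
    "(k::6) + 4 + 1 = k + 5" "(k::6) + 5 + 1 = k"
  by simp_all

text \<open>The corners kept complete. They include 5, where the inverse of \<open>h\<close> is
  placed and the finished hexagons are read off.\<close>

definition odd_6 :: "6 set" where
  "odd_6 = {1, 3, 5}"

lemma odd_6_cases: "k \<in> odd_6 \<Longrightarrow> c \<in> odd_6 \<longleftrightarrow> c = k \<or> c = k + 2 \<or> c = k + 4"
  unfolding odd_6_def by auto

definition around :: "6 \<Rightarrow> 'b \<Rightarrow> 'b \<Rightarrow> 'b \<Rightarrow> 'b \<Rightarrow> 'b \<Rightarrow> 'b \<Rightarrow> 6 \<Rightarrow> 'b" where
  "around k x0 x1 x2 x3 x4 x5 c =
     (if c = k then x0 else if c = k + 1 then x1 else if c = k + 2 then x2
      else if c = k + 3 then x3 else if c = k + 4 then x4 else x5)"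

lemma around_simps [simp]:
  "around k x0 x1 x2 x3 x4 x5 k = x0"
  "around k x0 x1 x2 x3 x4 x5 (k + 1) = x1"
  "around k x0 x1 x2 x3 x4 x5 (k + 2) = x2"
  "around k x0 x1 x2 x3 x4 x5 (k + 3) = x3"
  "around k x0 x1 x2 x3 x4 x5 (k + 4) = x4"
  "around k x0 x1 x2 x3 x4 x5 (k + 5) = x5"
  by (simp_all add: around_def)

text \<open>Excludes all words of length at most \<open>m\<close> in the translations and their
  inverses from carrying \<open>x\<close> into \<open>W\<close>. A coincidence between a fresh point
  and earlier ones shows up as such a word; the longest that occurs in \<open>resolve\<close> has
  length 4.\<close>

primrec fresh :: "nat \<Rightarrow> ('b \<Rightarrow> 'a \<Rightarrow> 'a) \<Rightarrow> 'a set \<Rightarrow> 'a \<Rightarrow> bool" where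
  "fresh 0 t W x \<longleftrightarrow> x \<notin> W"
| "fresh (Suc m) t W x \<longleftrightarrow> fresh m t W x \<and> (\<forall>c. fresh m t W (t c x) \<and> fresh m t W (finv (t c) x))"

lemma fresh_iterates:
  assumes "fresh 4 t W x"
  shows "x \<notin> W" "t c x \<notin> W" "t d (t c x) \<notin> W" "t e (t d (t c x)) \<notin> W"
    "finv (t c) x \<notin> W" "finv (t d) (finv (t c) x) \<notin> W"
    "finv (t e) (finv (t d) (finv (t c) x)) \<notin> W"
    "finv (t h) (finv (t e) (finv (t d) (finv (t c) x))) \<notin> W"
  using assms by (simp_all add: eval_nat_numeral)

text \<open>
  The finite set \<open>a c\<close> of pairs approximates an automorphism \<open>f\<^sub>c\<close>. The conjugate of \<open>g\<close> by
  \<open>f\<^sub>c\<close> is edge \<open>c\<close> of a hexagon; it leads from \<open>f\<^sub>c u\<close> to \<open>f\<^sub>c (g u)\<close>, and \<open>t c\<close> translates its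
  end point to the starting point of edge \<open>c + 1\<close>. A link at \<open>c\<close> is a point at which edge \<open>c\<close>
  arrives (via \<open>q\<close>) and edge \<open>c + 1\<close> departs (via \<open>u\<close>). A hole is an undefined point which,
  when added to the range of \<open>a (c + 1)\<close>, creates links on both of its sides.
\<close>

definition link :: "(6 \<Rightarrow> 'a \<Rightarrow> 'a) \<Rightarrow> (6 \<Rightarrow> ('a \<times> 'a) set) \<Rightarrow> 6 \<Rightarrow> 'a \<Rightarrow> 'a \<Rightarrow> bool" where
  "link t a c q u \<longleftrightarrow> (\<exists>x. (q, x) \<in> a c \<and> (u, t c x) \<in> a (c + 1))"

text \<open>Vertices are recorded by their preimages: the ends of edge \<open>c\<close> are the
  images of \<open>v c\<close> and \<open>g (v c)\<close> under the map approximated by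
  \<open>a c\<close>.\<close>

definition polygon :: "('a \<Rightarrow> 'a) \<Rightarrow> (6 \<Rightarrow> 'a \<Rightarrow> 'a) \<Rightarrow> (6 \<Rightarrow> ('a \<times> 'a) set) \<Rightarrow> (6 \<Rightarrow> 'a) \<Rightarrow> bool" where
  "polygon g t a v \<longleftrightarrow> (\<forall>c. link t a c (g (v c)) (v (c + 1)))"

definition resolved :: "('a \<Rightarrow> 'a) \<Rightarrow> (6 \<Rightarrow> 'a \<Rightarrow> 'a) \<Rightarrow> (6 \<Rightarrow> ('a \<times> 'a) set) \<Rightarrow> 6 \<Rightarrow> 'a \<Rightarrow> 'a \<Rightarrow> bool" where
  "resolved g t a c q u \<longleftrightarrow> (\<exists>v. polygon g t a v \<and> g (v c) = q \<and> v (c + 1) = u)"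

definition good :: "('a \<Rightarrow> 'a) \<Rightarrow> (6 \<Rightarrow> 'a \<Rightarrow> 'a) \<Rightarrow> (6 \<Rightarrow> ('a \<times> 'a) set) \<Rightarrow> bool" where
  "good g t a \<longleftrightarrow> (\<forall>c\<in>odd_6. \<forall>q u. link t a c q u \<longrightarrow> resolved g t a c q u)"

definition holes :: "(6 \<Rightarrow> 'a \<Rightarrow> 'a) \<Rightarrow> (6 \<Rightarrow> ('a \<times> 'a) set) \<Rightarrow> (6 \<times> 'a \<times> 'a) set" where
  "holes t a = {(c, q, r). c \<in> odd_6 \<and> (\<exists>x. (q, x) \<in> a c \<and>
      (r, t (c + 1) (t c x)) \<in> a (c + 2) \<and> t c x \<notin> Range (a (c + 1)))}"

lemma link_mono: "link t a c q u \<Longrightarrow> (\<And>c. a c \<subseteq> a' c) \<Longrightarrow> link t a' c q u"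
  unfolding link_def by blast

lemma polygon_mono: "polygon g t a v \<Longrightarrow> (\<And>c. a c \<subseteq> a' c) \<Longrightarrow> polygon g t a' v"
  unfolding polygon_def using link_mono by metis

lemma resolved_mono: "resolved g t a c q u \<Longrightarrow> (\<And>c. a c \<subseteq> a' c) \<Longrightarrow> resolved g t a' c q u"
  unfolding resolved_def using polygon_mono by metis

context one_point_rich
begin

lemma finite_not_fresh:
  assumes "\<And>c :: 'c :: finite. aut (t c)" "finite W"
  shows "finite {x. \<not> fresh m t W x}"
proof (induction m)
  case (Suc m)
  have eq: "{x. \<not> fresh (Suc m) t W x} = {x. \<not> fresh m t W x} \<union>
      (\<Union>c. t c -` {x. \<not> fresh m t W x} \<union> finv (t c) -` {x. \<not> fresh m t W x})"
    by auto
  have inj: "inj (t c)" "inj (finv (t c))" for c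
    using assms(1) aut_inv aut_permutes permutes_inj by blast+
  show ?case
    unfolding eq by (intro finite_UnI finite_UN_I finite finite_vimageI Suc inj)
qed (use assms in simp)

section \<open>Closing a hexagon over finite data\<close>

definition state :: "(6 \<Rightarrow> ('a \<times> 'a) set) \<Rightarrow> bool" where
  "state a \<longleftrightarrow> (\<forall>c. finite (a c) \<and> partial_iso (a c))"

lemma stateD: "state a \<Longrightarrow> finite (a c)" "state a \<Longrightarrow> partial_iso (a c)"
  by (auto simp: state_def)

lemma link_unique:
  assumes "state a" "aut (t c)" "link t a c q u" "link t a c q' u'"
  shows "q = q' \<longleftrightarrow> u = u'"
proof -
  obtain x x' where "(q, x) \<in> a c" "(u, t c x) \<in> a (c + 1)" "(q', x') \<in> a c" "(u', t c x') \<in> a (c + 1)"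
    using assms(3,4) unfolding link_def by blast
  then show ?thesis
    using partial_isoD(3)[OF stateD(2)[OF assms(1)]] aut_eq_iff[OF assms(2)] by metis
qed

text \<open>Linked pairs are those of the composite of \<open>a c\<close>, the automorphism
  \<open>t c\<close> and the converse of \<open>a (c + 1)\<close>, all of which preserve the
  relation.\<close>

lemma link_rel:
  assumes "state a" "aut (t c)" "list_all2 (link t a c) qs us"
  shows "qs \<in> R \<longleftrightarrow> us \<in> R"
proof -
  have "\<forall>i<length qs. \<exists>x. (qs ! i, x) \<in> a c \<and> (us ! i, t c x) \<in> a (c + 1)"
    using assms(3) unfolding list_all2_conv_all_nth link_def by blast
  then obtain x where x: "\<And>i. i < length qs \<Longrightarrow> (qs ! i, x i) \<in> a c \<and> (us ! i, t c (x i)) \<in> a (c + 1)"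
    by metis
  have len: "length us = length qs" using assms(3) by (simp add: list_all2_lengthD)
  define ps where "ps = map (\<lambda>i. (qs ! i, x i)) [0..<length qs]"
  define rs where "rs = map (\<lambda>i. (us ! i, t c (x i))) [0..<length qs]"
  have "set ps \<subseteq> a c" "set rs \<subseteq> a (c + 1)" using x by (auto simp: ps_def rs_def)
  then have "map fst ps \<in> R \<longleftrightarrow> map snd ps \<in> R" "map fst rs \<in> R \<longleftrightarrow> map snd rs \<in> R"
    using partial_isoD(4) stateD(2)[OF assms(1)] by blast+
  moreover have "map fst ps = qs" "map fst rs = us" "map snd rs = map (t c) (map snd ps)"
    using len by (auto simp: ps_def rs_def comp_def intro: nth_equalityI)
  moreover have "set (map snd ps) \<subseteq> U"
    using \<open>set ps \<subseteq> a c\<close> partial_isoD(2)[OF stateD(2)[OF assms(1)]] by auto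
  ultimately show ?thesis using aut_rel[OF assms(2)] by metis
qed

text \<open>The path \<open>v\<close> is broken only at corner \<open>b\<close>. A meeting point
  must have the type of \<open>g (v b)\<close> on the arriving side and that of
  \<open>v (b + 1)\<close> on the departing side. The unbroken rest of the path shows that these
  agree over points lying on complete hexagons.\<close>

lemma close_polygon:
  assumes a: "state a" and t: "\<And>c. aut (t c)" and g: "aut g"
    and links: "\<And>c. c \<noteq> b \<Longrightarrow> link t a c (g (v c)) (v (c + 1))"
    and res: "\<And>q u. link t a b q u \<Longrightarrow> resolved g t a b q u"
    and out: "g (v b) \<notin> Domain (a b)" "v (b + 1) \<notin> Domain (a (b + 1))" and F: "finite F"
  shows "\<exists>z\<in>U - F. partial_iso (insert (g (v b), finv (t b) z) (a b)) \<and>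
      partial_iso (insert (v (b + 1), z) (a (b + 1)))"
proof -
  note iso = stateD(2)[OF a] and fin = stateD(1)[OF a]
  \<comment> \<open>The translation \<open>t b\<close> is absorbed into the arriving side, so that
    both converses start from the points at which the two sides meet.\<close>
  define E1 where "E1 = ((\<lambda>(s, x). (s, t b x)) ` a b)\<inverse>"
  define E2 where "E2 = (a (b + 1))\<inverse>"
  have E1: "partial_iso E1" "finite E1"
    unfolding E1_def using partial_iso_aut_snd[OF iso t] fin by auto
  have E2: "partial_iso E2" "finite E2" unfolding E2_def using iso fin by auto
  have in_U: "q \<in> U \<and> u \<in> U" if "link t a c q u" for c q u
    using that partial_isoD(1)[OF iso] unfolding link_def by blast
  have v_U: "v c \<in> U" for c
  proof (cases "c = b")
    case False
    then show ?thesis using in_U[OF links] aut_in_iff[OF g] by blast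
  next
    case True
    have "b + 5 \<noteq> b" by simp
    from in_U[OF links[OF this]] show ?thesis using True unfolding add_6 by simp
  qed
  have "\<exists>z\<in>U - F. z \<notin> Domain E1 \<and> z \<notin> Domain E2 \<and>
    partial_iso (insert (z, g (v b)) E1) \<and> partial_iso (insert (z, v (b + 1)) E2)"
  proof (rule ex_amalgam[OF E1 E2])
    show "g (v b) \<in> U" "v (b + 1) \<in> U" using v_U aut_in_iff[OF g] by auto
    show "g (v b) \<notin> Range E1" "v (b + 1) \<notin> Range E2"
      using out by (auto simp: E1_def E2_def)
  next
    fix L assume L: "\<And>y s1 s2. (y, s1, s2) \<in> set L \<Longrightarrow> (y, s1) \<in> E1 \<and> (y, s2) \<in> E2"
    have "\<forall>p\<in>set L. \<exists>w. polygon g t a w \<and> g (w b) = fst (snd p) \<and> w (b + 1) = snd (snd p)"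
    proof
      fix p assume p: "p \<in> set L"
      obtain y s1 s2 where [simp]: "p = (y, s1, s2)" by (cases p) auto
      have "link t a b s1 s2" using L[of y s1 s2] p by (auto simp: E1_def E2_def link_def)
      from res[OF this] show "\<exists>w. polygon g t a w \<and> g (w b) = fst (snd p) \<and> w (b + 1) = snd (snd p)"
        by (simp add: resolved_def)
    qed
    then obtain w where w: "\<And>p. p \<in> set L \<Longrightarrow> polygon g t a (w p)"
        "\<And>p. p \<in> set L \<Longrightarrow> g (w p b) = fst (snd p)" "\<And>p. p \<in> set L \<Longrightarrow> w p (b + 1) = snd (snd p)"
      by metis
    \<comment> \<open>The broken path and the complete hexagons through the common points are
      carried along together. Applying \<open>g\<close> and crossing the five corners other than
      \<open>b\<close> preserves the relation, which compares the two sides of \<open>b\<close> the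
      long way round.\<close>
    define P where "P c = v c # map (\<lambda>p. w p c) L" for c
    have "set (P c) \<subseteq> U" for c
      using v_U w(1) in_U aut_in_iff[OF g] unfolding P_def polygon_def by fastforce
    from aut_rel[OF g this] have gP: "map g (P c) \<in> R \<longleftrightarrow> P c \<in> R" for c .
    have step: "map g (P c) \<in> R \<longleftrightarrow> P (c + 1) \<in> R" if "c \<noteq> b" for c
    proof (rule link_rel[OF a t])
      show "list_all2 (link t a c) (map g (P c)) (P (c + 1))"
        using links[OF that] w(1) unfolding P_def polygon_def
        by (auto simp: list_all2_map1 list_all2_map2 intro: list.rel_refl_strong)
    qed
    have adj: "P c \<in> R \<longleftrightarrow> P (c + 1) \<in> R" if "c \<noteq> b" for c
      using step[OF that] gP by blast
    have "P (b + 1) \<in> R \<longleftrightarrow> P b \<in> R"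
      using adj[of "b + 1"] adj[of "b + 2"] adj[of "b + 3"] adj[of "b + 4"] adj[of "b + 5"]
      unfolding add_6 by simp
    then have "map g (P b) \<in> R \<longleftrightarrow> P (b + 1) \<in> R" using gP by blast
    moreover have "map g (P b) = g (v b) # map (fst \<circ> snd) L"
      using w(2) by (simp add: P_def)
    moreover have "P (b + 1) = v (b + 1) # map (snd \<circ> snd) L"
      using w(3) by (simp add: P_def)
    ultimately show "g (v b) # map (fst \<circ> snd) L \<in> R \<longleftrightarrow> v (b + 1) # map (snd \<circ> snd) L \<in> R"
      by simp
  qed (rule F)
  then obtain z where z: "z \<in> U - F" "partial_iso (insert (z, g (v b)) E1)"
    "partial_iso (insert (z, v (b + 1)) E2)" by blast
  have "(\<lambda>(s, x). (s, finv (t b) x)) ` (\<lambda>(s, x). (s, t b x)) ` a b = a b"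
    using t by (simp add: image_image case_prod_unfold)
  moreover have "(insert (z, g (v b)) E1)\<inverse> = insert (g (v b), z) ((\<lambda>(s, x). (s, t b x)) ` a b)"
    by (auto simp: E1_def)
  ultimately have "(\<lambda>(s, x). (s, finv (t b) x)) ` ((insert (z, g (v b)) E1)\<inverse>) =
      insert (g (v b), finv (t b) z) (a b)"
    by simp
  then have "partial_iso (insert (g (v b), finv (t b) z) (a b))"
    using partial_iso_aut_snd[OF _ aut_inv[OF t], of "(insert (z, g (v b)) E1)\<inverse>" b] z(2) by simp
  moreover have "(insert (z, v (b + 1)) E2)\<inverse> = insert (v (b + 1), z) (a (b + 1))"
    by (auto simp: E2_def)
  then have "partial_iso (insert (v (b + 1), z) (a (b + 1)))"
    using z(3) partial_iso_converse by metis
  ultimately show ?thesis using z(1) by blast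
qed

text \<open>An existing image is kept, because a path has to follow edges already defined; only
  otherwise is a fresh one chosen. The disjunction lets later arguments tell the two cases
  apart.\<close>

lemma ensure_domain:
  assumes "partial_iso E" "finite E" "u \<in> U" "finite W" and t: "\<And>c :: 'c :: finite. aut (t c)"
  shows "\<exists>x E'. (u, x) \<in> E' \<and> partial_iso E' \<and> finite E' \<and> x \<in> U \<and>
    (E' = E \<or> E' = insert (u, x) E \<and> u \<notin> Domain E \<and> fresh 4 t W x)"
proof (cases "u \<in> Domain E")
  case True
  then obtain x where x: "(u, x) \<in> E" by blast
  then have "x \<in> U" using partial_isoD(2)[OF assms(1)] by blast
  with x assms(1,2) show ?thesis by blast
next
  case False
  from ex_extension_range[OF assms(1-3) False finite_not_fresh[where t = t and m = 4, OF t assms(4)]]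
  obtain x where "x \<in> U" "fresh 4 t W x" "partial_iso (insert (u, x) E)" by blast
  then show ?thesis
    using False assms(2) by (intro exI[of _ x] exI[of _ "insert (u, x) E"]) simp
qed

text \<open>For a new preimage \<open>u\<close>, the conditions on \<open>g\<close> leave
  \<open>g u\<close> and \<open>finv g u\<close> undefined even after \<open>u\<close> is inserted,
  so a path can be continued freely in either direction.\<close>

lemma ensure_range:
  assumes "partial_iso E" "finite E" "x \<in> U" and g: "aut g" "g \<noteq> id"
  shows "\<exists>u E'. (u, x) \<in> E' \<and> partial_iso E' \<and> finite E' \<and> u \<in> U \<and>
    (E' = E \<or> E' = insert (u, x) E \<and> u \<notin> Domain E \<and> x \<notin> Range E \<and>
      g u \<noteq> u \<and> g u \<notin> Domain E \<and> finv g u \<notin> Domain E)"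
proof (cases "x \<in> Range E")
  case True
  then obtain u where u: "(u, x) \<in> E" by blast
  then have "u \<in> U" using partial_isoD(1)[OF assms(1)] by blast
  with u assms(1,2) show ?thesis by blast
next
  case False
  have "finite (Domain E)" using assms(2) by (rule finite_Domain)
  from ex_moved_extension[OF assms(1-3) False this g]
  obtain u where "u \<in> U" "u \<notin> Domain E" "g u \<noteq> u" "g u \<notin> Domain E" "finv g u \<notin> Domain E"
    "partial_iso (insert (u, x) E)" by blast
  then show ?thesis
    using False assms(2) by (intro exI[of _ u] exI[of _ "insert (u, x) E"]) simp
qed

text \<open>
  The unresolved link is resolved by completing its polygon: leftwards the polygon may run
  through up to two edges that are already present, rightwards it is fresh, and both sides
  meet at boundary \<open>k + 2\<close>, where all links are resolved and hence the two types imposed on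
  the meeting point agree. At most one new unresolved odd link arises, and in that
  case a hole has been filled and none created, so the number of holes decreases.
\<close>

lemma resolve:
  assumes g: "aut g" "g \<noteq> id" and t: "\<And>c :: 6. aut (t c)"
    and "state a" "k \<in> odd_6" "link t a k q u"
    and "\<And>y. (g u, y) \<in> a (k + 1) \<Longrightarrow> t (k + 1) y \<notin> Range (a (k + 2)) \<and>
      t (k + 2) (t (k + 1) y) \<notin> Range (a (k + 3)) \<and>
      t (k + 3) (t (k + 2) (t (k + 1) y)) \<notin> Range (a (k + 4))"
    and "\<And>c q' u'. c \<in> odd_6 \<Longrightarrow> link t a c q' u' \<Longrightarrow>
      resolved g t a c q' u' \<or> c = k \<and> q' = q \<and> u' = u"
  shows "\<exists>a'. (\<forall>c. a c \<subseteq> a' c) \<and> state a' \<and> good g t a'"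
  using assms(4-)
proof (induction "card (holes t a)" arbitrary: a k q u rule: less_induct)
  case less
  note a = less.prems(1) and k = less.prems(2) and kqu = less.prems(3)
    and right = less.prems(4) and others = less.prems(5)
  note iso = stateD(2)[OF a] and fin = stateD(1)[OF a]
  note odd = odd_6_cases[OF k]
  note auti = aut_inv[OF t] and gi = aut_inv[OF g(1)]
  show ?case
  proof (cases "resolved g t a k q u")
    case True
    then have "good g t a" using others unfolding good_def by blast
    then show ?thesis using a by blast
  next
    case unres: False
    obtain x0 where x0: "(q, x0) \<in> a k" "(u, t k x0) \<in> a (k + 1)"
      using kqu unfolding link_def by blast
    have gg: "g (finv g s) = s" for s using g(1) by simp
    have uU: "u \<in> U" "g u \<in> U" and qU: "q \<in> U" "finv g q \<in> U"
      using partial_isoD(1)[OF iso] x0 aut_in_iff[OF g(1)] aut_in_iff[OF gi] by auto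
    define W where "W = (\<Union>c. Range (a c))"
    have W: "finite W" unfolding W_def using fin by (simp add: finite_Range)
    have RW: "y \<in> W" if "(s, y) \<in> a c" for s y c using that unfolding W_def by blast

    from ensure_domain[where t = t, OF iso[of "k + 1"] fin uU(2) W t]
    obtain y E1 where y: "(g u, y) \<in> E1" "partial_iso E1" "finite E1" "y \<in> U"
      and E1: "E1 = a (k + 1) \<or> E1 = insert (g u, y) (a (k + 1)) \<and> g u \<notin> Domain (a (k + 1)) \<and> fresh 4 t W y"
      by (elim exE conjE) (rule that)
    \<comment> \<open>The three exclusions serve different ends: the first makes the preimage of
      \<open>r2\<close> new, the second keeps \<open>r2\<close> from creating a link at corner
      \<open>k + 2\<close>, and the third keeps it from creating a hole between edges
      \<open>k + 2\<close> and \<open>k + 4\<close>.\<close>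
    have y_out: "(s, t (k + 1) y) \<notin> a (k + 2)" "(s, t (k + 2) (t (k + 1) y)) \<notin> a (k + 3)"
      "(s, t (k + 3) (t (k + 2) (t (k + 1) y))) \<notin> a (k + 4)" for s
    proof -
      have "(s, t (k + 1) y) \<notin> a (k + 2) \<and> (s, t (k + 2) (t (k + 1) y)) \<notin> a (k + 3) \<and>
        (s, t (k + 3) (t (k + 2) (t (k + 1) y))) \<notin> a (k + 4)"
        using E1
      proof (elim disjE conjE)
        assume "E1 = a (k + 1)"
        then show ?thesis using right[of y] y(1) by blast
      next
        assume "fresh 4 t W y"
        from fresh_iterates(2-4)[OF this] show ?thesis using RW by blast
      qed
      then show "(s, t (k + 1) y) \<notin> a (k + 2)" "(s, t (k + 2) (t (k + 1) y)) \<notin> a (k + 3)"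
        "(s, t (k + 3) (t (k + 2) (t (k + 1) y))) \<notin> a (k + 4)" by blast+
    qed

    define v0 where "v0 = finv g q"
    have gv0: "g v0 = q" unfolding v0_def by (rule gg)
    have "v0 \<in> U" unfolding v0_def by (rule qU(2))
    moreover have "finite (insert y W)" using W by simp
    ultimately have "\<exists>x E'. (v0, x) \<in> E' \<and> partial_iso E' \<and> finite E' \<and> x \<in> U \<and>
        (E' = a k \<or> E' = insert (v0, x) (a k) \<and> v0 \<notin> Domain (a k) \<and> fresh 4 t (insert y W) x)"
      by (rule ensure_domain[where t = t, OF iso fin _ _ t])
    then
    obtain p E0 where p: "(v0, p) \<in> E0" "partial_iso E0" "finite E0" "p \<in> U"
      and E0: "E0 = a k \<or> E0 = insert (v0, p) (a k) \<and> v0 \<notin> Domain (a k) \<and> fresh 4 t (insert y W) p"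
      by (elim exE conjE) (rule that)

    define r where "r = finv (t (k + 5)) p"
    have tr: "t (k + 5) r = p" unfolding r_def using t by simp
    have "r \<in> U" unfolding r_def using aut_in_iff[OF auti] p(4) by blast
    from ensure_range[OF iso[of "k + 5"] fin this g]
    obtain f F5 where f: "(f, r) \<in> F5" "partial_iso F5" "finite F5" "f \<in> U"
      and F5: "F5 = a (k + 5) \<or> F5 = insert (f, r) (a (k + 5)) \<and> f \<notin> Domain (a (k + 5)) \<and>
        r \<notin> Range (a (k + 5)) \<and> g f \<noteq> f \<and> g f \<notin> Domain (a (k + 5)) \<and> finv g f \<notin> Domain (a (k + 5))"
      by (elim exE conjE) (rule that)

    define v5 where "v5 = finv g f"
    have gv5: "g v5 = f" unfolding v5_def by (rule gg)
    have "v5 \<in> U" unfolding v5_def using aut_in_iff[OF gi] f(4) by blast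
    moreover have "finite (insert p (insert y W))" using W by simp
    ultimately have "\<exists>x E'. (v5, x) \<in> E' \<and> partial_iso E' \<and> finite E' \<and> x \<in> U \<and>
        (E' = F5 \<or> E' = insert (v5, x) F5 \<and> v5 \<notin> Domain F5 \<and> fresh 4 t (insert p (insert y W)) x)"
      by (rule ensure_domain[where t = t, OF f(2,3) _ _ t])
    then obtain p5 E5 where p5: "(v5, p5) \<in> E5" "partial_iso E5" "finite E5" "p5 \<in> U"
      and E5: "E5 = F5 \<or> E5 = insert (v5, p5) F5 \<and> v5 \<notin> Domain F5 \<and> fresh 4 t (insert p (insert y W)) p5"
      by (elim exE conjE) (rule that)
    \<comment> \<open>A new \<open>f\<close> is moved by \<open>g\<close>, and
      \<open>finv g f\<close> lies outside the old domain; hence \<open>v5\<close> has no image yet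
      and \<open>p5\<close> is chosen fresh.\<close>
    have p5_fresh: "E5 = insert (v5, p5) F5 \<and> fresh 4 t (insert p (insert y W)) p5" if "F5 \<noteq> a (k + 5)"
    proof -
      have F5': "F5 = insert (f, r) (a (k + 5))" "g f \<noteq> f" "finv g f \<notin> Domain (a (k + 5))"
        using F5 that by blast+
      then have "v5 \<noteq> f" using gv5 by metis
      then have "v5 \<notin> Domain F5" using F5' unfolding v5_def by blast
      then show ?thesis using E5 p5(1) by blast
    qed

    define r4 where "r4 = finv (t (k + 4)) p5"
    have tr4: "t (k + 4) r4 = p5" unfolding r4_def using t by simp
    have r4U: "r4 \<in> U" unfolding r4_def using aut_in_iff[OF auti] p5(4) by blast
    \<comment> \<open>The leftward run stops here. An existing \<open>r4\<close> would give a link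
      at the odd corner \<open>k + 4\<close>, which is resolved. The hexagon through it runs along
      edges \<open>k + 5\<close> and \<open>k\<close> into the link from \<open>q\<close> to
      \<open>u\<close>, contrary to \<open>unres\<close>.\<close>
    have r4_new: "r4 \<notin> Range (a (k + 4))"
    proof
      assume "r4 \<in> Range (a (k + 4))"
      then obtain s where s: "(s, r4) \<in> a (k + 4)" by blast
      have "\<not> fresh 4 t (insert p (insert y W)) p5"
        using fresh_iterates(5)[of t "insert p (insert y W)" p5 "k + 4"] RW[OF s] unfolding r4_def by blast
      then have old: "F5 = a (k + 5)" "E5 = a (k + 5)" using E5 p5_fresh by auto
      then have "link t a (k + 4) s v5"
        using s p5(1) tr4 unfolding link_def add_6 by blast
      moreover have "k + 4 \<noteq> k" by simp
      ultimately have "resolved g t a (k + 4) s v5" using others odd by blast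
      then obtain V where V: "polygon g t a V" "V (k + 5) = v5"
        unfolding resolved_def add_6 by blast
      have "link t a (k + 5) f (V k)" "link t a k (g (V k)) (V (k + 1))"
        using V gv5 unfolding polygon_def by (metis add_6(5))+
      then obtain x where x: "(f, x) \<in> a (k + 5)" "(V k, t (k + 5) x) \<in> a k"
        unfolding link_def add_6 by blast
      have "x = r" using partial_isoD(3)[OF iso x(1)] f(1) old by blast
      then have Vk: "(V k, p) \<in> a k" using x(2) tr by blast
      have "E0 = a k"
        using E0 fresh_iterates(1)[of t "insert y W" p] RW[OF Vk] by blast
      then have "V k = v0" using partial_isoD(3)[OF iso Vk] p(1) by blast
      then have "g (V k) = q" using gv0 by simp
      moreover have "V (k + 1) = u"
        using link_unique[OF a t kqu] \<open>link t a k (g (V k)) (V (k + 1))\<close> \<open>g (V k) = q\<close> by blast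
      ultimately show False using unres V(1) unfolding resolved_def by blast
    qed
    have "finite (Domain (a (k + 4)))" using fin by (simp add: finite_Domain)
    from ex_moved_extension[OF iso fin r4U r4_new this g]
    obtain f4 where f4: "f4 \<in> U" "f4 \<notin> Domain (a (k + 4))" "g f4 \<noteq> f4" "finv g f4 \<notin> Domain (a (k + 4))"
      and F4: "partial_iso (insert (f4, r4) (a (k + 4)))" by blast
    define F4 where "F4 = insert (f4, r4) (a (k + 4))"
    define v4 where "v4 = finv g f4"
    have gv4: "g v4 = f4" unfolding v4_def by (rule gg)
    have v4U: "v4 \<in> U" unfolding v4_def using aut_in_iff[OF gi] f4(1) by blast
    have "v4 \<noteq> f4" using gv4 f4(3) by metis
    then have v4_new: "v4 \<notin> Domain F4" using f4(4) unfolding F4_def v4_def by blast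
    have F4': "partial_iso F4" "finite F4" using F4 fin unfolding F4_def by auto
    \<comment> \<open>The sets to be avoided grow in the order \<open>y\<close>, \<open>p\<close>,
      \<open>p5\<close>, \<open>p4\<close>, \<open>z\<close>. A coincidence between translates of
      these points thus becomes a word that carries a later, fresh point to an earlier one.\<close>
    have fin4: "finite (insert p5 (insert p (insert y W)))" using W by simp
    from ex_extension_range[OF F4' v4U v4_new finite_not_fresh[where t = t and m = 4, OF t fin4]]
    obtain p4 where p4: "p4 \<in> U" "fresh 4 t (insert p5 (insert p (insert y W))) p4"
      "partial_iso (insert (v4, p4) F4)" by blast
    define E4 where "E4 = insert (v4, p4) F4"
    note p4f = fresh_iterates[OF p4(2)]

    define r3 where "r3 = finv (t (k + 3)) p4"
    have tr3: "t (k + 3) r3 = p4" unfolding r3_def using t by simp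
    have r3U: "r3 \<in> U" unfolding r3_def using aut_in_iff[OF auti] p4(1) by blast
    have r3_new: "r3 \<notin> Range (a (k + 3))" using p4f(5) RW unfolding r3_def by blast
    have "finite (Domain (a (k + 3)))" using fin by (simp add: finite_Domain)
    from ex_moved_extension[OF iso fin r3U r3_new this g]
    obtain f3 where f3: "f3 \<in> U" "f3 \<notin> Domain (a (k + 3))" "g f3 \<noteq> f3" "finv g f3 \<notin> Domain (a (k + 3))"
      and F3: "partial_iso (insert (f3, r3) (a (k + 3)))" by blast
    define F3 where "F3 = insert (f3, r3) (a (k + 3))"
    define v3 where "v3 = finv g f3"
    have gv3: "g v3 = f3" unfolding v3_def by (rule gg)
    have "v3 \<noteq> f3" using gv3 f3(3) by metis
    then have v3_new: "v3 \<notin> Domain F3" using f3(4) unfolding F3_def v3_def by blast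

    define r2 where "r2 = t (k + 1) y"
    have r2U: "r2 \<in> U" unfolding r2_def using aut_in_iff[OF t] y(4) by blast
    have r2_new: "r2 \<notin> Range (a (k + 2))" using y_out(1) unfolding r2_def by blast
    have "finite (Domain (a (k + 2)))" using fin by (simp add: finite_Domain)
    from ex_moved_extension[OF iso fin r2U r2_new this g]
    obtain w where w: "w \<in> U" "w \<notin> Domain (a (k + 2))" "g w \<noteq> w" "g w \<notin> Domain (a (k + 2))"
      and F2: "partial_iso (insert (w, r2) (a (k + 2)))" by blast
    define F2 where "F2 = insert (w, r2) (a (k + 2))"
    have gw_new: "g w \<notin> Domain F2" using w(3,4) unfolding F2_def by blast

    \<comment> \<open>Everything except the two pairs that meet at corner \<open>k + 2\<close>: the
      images of \<open>g w\<close> and \<open>v3\<close> are still undefined.\<close>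
    define b where "b = around k E0 E1 F2 F3 E4 E5"
    have b: "state b"
      unfolding state_def all_6[of _ k] b_def
      using p y p5 F2 F3 F4' p4(3) fin by (simp add: F2_def F3_def E4_def)
    have aE0: "a k \<subseteq> E0" and aE1: "a (k + 1) \<subseteq> E1" and aF5: "a (k + 5) \<subseteq> F5" and F5E5: "F5 \<subseteq> E5"
      using E0 E1 F5 E5 by blast+
    have "\<forall>c. a c \<subseteq> b c"
      unfolding all_6[of _ k] b_def
      using aE0 aE1 aF5 F5E5 by (auto simp: F2_def F3_def E4_def F4_def)
    then have ab: "a c \<subseteq> b c" for c by blast
    define v where "v = around k v0 u w v3 v4 v5"
    have links: "link t b c (g (v c)) (v (c + 1))" if "c \<noteq> k + 2" for c
    proof -
      have "\<forall>c. c \<noteq> k + 2 \<longrightarrow> link t b c (g (v c)) (v (c + 1))"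
        unfolding all_6[of _ k]
      proof (intro conjI impI; (unfold add_6)?)
        show "link t b k (g (v k)) (v (k + 1))"
          unfolding link_def b_def v_def using x0 gv0 aE0 aE1 by auto
        show "link t b (k + 1) (g (v (k + 1))) (v (k + 2))"
          unfolding link_def add_6 b_def v_def using y(1) by (auto simp: F2_def r2_def)
        show "link t b (k + 3) (g (v (k + 3))) (v (k + 4))"
          unfolding link_def add_6 b_def v_def using gv3 tr3 by (auto simp: F3_def E4_def)
        show "link t b (k + 4) (g (v (k + 4))) (v (k + 5))"
          unfolding link_def add_6 b_def v_def using gv4 tr4 p5(1) by (auto simp: E4_def F4_def)
        show "link t b (k + 5) (g (v (k + 5))) (v k)"
          unfolding link_def add_6 b_def v_def using gv5 tr p(1) f(1) F5E5 by auto
      qed auto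
      then show ?thesis using that by blast
    qed
    have old_res: "resolved g t b c q' u'" if "link t a c q' u'" "c \<in> odd_6" "c \<noteq> k" for c q' u'
      using others[OF that(2,1)] that(3) resolved_mono[where a = a and a' = b, OF _ ab] by blast
    \<comment> \<open>The points added so far create no link at corner \<open>k + 2\<close>. All
      links there are old, and they are resolved because \<open>k + 2\<close> is odd and differs
      from \<open>k\<close>; this is what \<open>close_polygon\<close> requires.\<close>
    have link2: "link t a (k + 2) q' u'" if "(q', x) \<in> F2" "(u', t (k + 2) x) \<in> F3" for q' u' x
    proof -
      have "(q', x) \<in> a (k + 2)"
      proof (rule ccontr)
        assume "(q', x) \<notin> a (k + 2)"
        then have x: "x = r2" using that(1) unfolding F2_def by blast
        then have "t (k + 2) (t (k + 1) y) = r3"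
          using that(2) y_out(2) unfolding F3_def r2_def by blast
        then have "finv (t (k + 1)) (finv (t (k + 2)) (finv (t (k + 3)) p4)) = y"
          unfolding r3_def[symmetric] using t by (metis aut_inv_apply(1))
        then show False using p4f(7) by blast
      qed
      moreover have "t (k + 2) x \<noteq> r3"
      proof
        assume "t (k + 2) x = r3"
        then have "finv (t (k + 2)) (finv (t (k + 3)) p4) = x"
          unfolding r3_def[symmetric] using t by (metis aut_inv_apply(1))
        then show False using p4f(6) RW[OF calculation] by blast
      qed
      ultimately show ?thesis using that(2) unfolding link_def add_6 F3_def by blast
    qed
    have "\<exists>z\<in>U - {z. \<not> fresh 4 t (insert p4 (insert p5 (insert p (insert y W)))) z}.
        partial_iso (insert (g (v (k + 2)), finv (t (k + 2)) z) (b (k + 2))) \<and>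
        partial_iso (insert (v (k + 2 + 1), z) (b (k + 2 + 1)))"
    proof (rule close_polygon[OF b t g(1) links])
      fix q' u' assume "link t b (k + 2) q' u'"
      then have "link t a (k + 2) q' u'"
        using link2 unfolding link_def add_6 b_def by auto
      then show "resolved g t b (k + 2) q' u'" by (rule old_res) (use odd in simp_all)
    next
      show "g (v (k + 2)) \<notin> Domain (b (k + 2))" using gw_new by (simp add: v_def b_def)
      show "v (k + 2 + 1) \<notin> Domain (b (k + 2 + 1))"
        unfolding add_6 using v3_new by (simp add: v_def b_def)
      have "finite (insert p4 (insert p5 (insert p (insert y W))))" using W by simp
      from finite_not_fresh[where t = t, OF t this]
      show "finite {z. \<not> fresh 4 t (insert p4 (insert p5 (insert p (insert y W)))) z}" .
    qed
    then obtain z where z: "fresh 4 t (insert p4 (insert p5 (insert p (insert y W)))) z"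
      and E2': "partial_iso (insert (g w, finv (t (k + 2)) z) F2)"
      and E3': "partial_iso (insert (v3, z) F3)"
      unfolding add_6 by (auto simp: v_def b_def)
    note zf = fresh_iterates[OF z]
    define z2 where "z2 = finv (t (k + 2)) z"
    have tz2: "t (k + 2) z2 = z" unfolding z2_def using t by simp
    define E2 where "E2 = insert (g w, z2) F2"
    define E3 where "E3 = insert (v3, z) F3"
    define a' where "a' = around k E0 E1 E2 E3 E4 E5"
    have a': "state a'"
      unfolding state_def all_6[of _ k] a'_def
      using p y p5 E2' E3' F4' p4(3) fin by (simp add: F2_def F3_def E4_def E2_def E3_def z2_def)
    have "\<forall>c. b c \<subseteq> a' c"
      unfolding all_6[of _ k] b_def a'_def by (auto simp: E2_def E3_def)
    then have ba': "b c \<subseteq> a' c" for c by blast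
    have aa': "a c \<subseteq> a' c" for c using ab ba' by blast
    have poly: "polygon g t a' v"
      unfolding polygon_def
    proof
      fix c
      show "link t a' c (g (v c)) (v (c + 1))"
      proof (cases "c = k + 2")
        case True
        show ?thesis
          unfolding True link_def add_6 a'_def v_def using tz2 by (auto simp: E2_def E3_def)
      next
        case False
        from link_mono[OF links[OF this] ba'] show ?thesis .
      qed
    qed
    have v_res: "resolved g t a' c (g (v c)) (v (c + 1))" for c
      using poly unfolding resolved_def by blast
    have old_res': "resolved g t a' c q' u'" if "link t a c q' u'" "c \<in> odd_6" for c q' u'
      using others[OF that(2,1)]
    proof (elim disjE conjE)
      assume "resolved g t a c q' u'"
      from resolved_mono[OF this aa'] show ?thesis .
    next
      assume "c = k" "q' = q" "u' = u"
      then show ?thesis using v_res[of k] gv0 by (simp add: v_def)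
    qed
    \<comment> \<open>The only odd links that can escape resolution depart via a newly inserted
      \<open>f\<close>: its image \<open>r\<close> was then put next to an old point of edge
      \<open>k + 4\<close>.\<close>
    have hole_link: "resolved g t a' c q' u' \<or>
        c = k + 4 \<and> u' = f \<and> F5 \<noteq> a (k + 5) \<and> (\<exists>x. (q', x) \<in> a (k + 4) \<and> t (k + 4) x = r)"
      if l: "link t a' c q' u'" and c: "c \<in> odd_6" for c q' u'
    proof -
      consider "c = k" | "c = k + 2" | "c = k + 4" using odd c by blast
      then show ?thesis
      proof cases
        case 1
        then obtain x where x: "(q', x) \<in> E0" "(u', t k x) \<in> E1"
          using l unfolding 1 link_def add_6 a'_def by auto
        have q'x: "(q', x) \<in> a k"
        proof (rule ccontr)
          assume "(q', x) \<notin> a k"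
          then have "x = p" and pf: "fresh 4 t (insert y W) p" using E0 x(1) by blast+
          then have "t k p \<in> insert y W" using x(2) E1 RW by blast
          then show False using fresh_iterates(2)[OF pf] by blast
        qed
        moreover have "(u', t k x) \<in> a (k + 1)"
        proof (rule ccontr)
          assume "(u', t k x) \<notin> a (k + 1)"
          then have "t k x = y" and yf: "fresh 4 t W y" using E1 x(2) by blast+
          then have "finv (t k) y = x" using t by (metis aut_inv_apply(1))
          then show False using fresh_iterates(5)[OF yf] RW[OF q'x] by blast
        qed
        ultimately have "link t a c q' u'" unfolding link_def 1 by blast
        then show ?thesis using old_res' c by blast
      next
        case 2
        then obtain x where x: "(q', x) \<in> E2" "(u', t (k + 2) x) \<in> E3"
          using l unfolding 2 link_def add_6 a'_def by auto
        have rng: "s \<in> insert p4 (insert p5 (insert p (insert y W))) \<or> s = r3" if "(x', s) \<in> F3" for x' s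
          using that RW unfolding F3_def by blast
        have z_r3: "z \<noteq> r3"
        proof
          assume "z = r3"
          then have "t (k + 3) z = p4" using tr3 by simp
          then show False using zf(2) by blast
        qed
        have z2_F2: "(x', z2) \<notin> F2" for x'
        proof
          assume "(x', z2) \<in> F2"
          then have "z2 = r2 \<or> z2 \<in> W" using RW unfolding F2_def by blast
          then show False
          proof
            assume "z2 = r2"
            then have "finv (t (k + 1)) (finv (t (k + 2)) z) = y"
              unfolding z2_def[symmetric] r2_def using t by simp
            then show False using zf(6) by blast
          next
            assume "z2 \<in> W"
            then show False using zf(5) unfolding z2_def by blast
          qed
        qed
        show ?thesis
        proof (cases "t (k + 2) x = z")
          case True
          then have "x = z2" using tz2 aut_eq_iff[OF t] by metis
          then have "q' = g w" using x(1) z2_F2 unfolding E2_def by blast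
          moreover have "u' = v3" using x(2) True rng zf(1) z_r3 unfolding E3_def by blast
          ultimately show ?thesis
            using v_res[of "k + 2"] unfolding 2 add_6 by (simp add: v_def)
        next
          case False
          then have "x \<noteq> z2" using tz2 by blast
          then have "link t a (k + 2) q' u'" using link2 x False unfolding E2_def E3_def by blast
          then show ?thesis using old_res' c 2 by blast
        qed
      next
        case 3
        then obtain x where x: "(q', x) \<in> E4" "(u', t (k + 4) x) \<in> E5"
          using l unfolding 3 link_def add_6 a'_def by auto
        have "x \<noteq> p4"
        proof
          assume "x = p4"
          then have "t (k + 4) p4 \<in> insert p5 W \<or> t (k + 4) p4 = r"
            using x(2) E5 F5 RW by blast
          then show False
          proof
            assume "t (k + 4) p4 \<in> insert p5 W"
            then show False using p4f(2) by blast
          next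
            assume "t (k + 4) p4 = r"
            then have "t (k + 5) (t (k + 4) p4) = p" using tr by simp
            then show False using p4f(3) by blast
          qed
        qed
        then have x4: "(q', x) = (f4, r4) \<or> (q', x) \<in> a (k + 4)"
          using x(1) unfolding E4_def F4_def by blast
        show ?thesis
        proof (cases "t (k + 4) x = p5")
          case True
          then have "x = r4" using tr4 aut_eq_iff[OF t] by metis
          then have "q' = f4" using x4 r4_new by blast
          moreover have "u' = v5" using partial_isoD(3)[OF p5(2) x(2)] p5(1) True by blast
          ultimately show ?thesis
            using v_res[of "k + 4"] gv4 unfolding 3 add_6 by (simp add: v_def)
        next
          case False
          then have "x \<noteq> r4" using tr4 by blast
          then have q'x: "(q', x) \<in> a (k + 4)" using x4 by blast
          have u'x: "(u', t (k + 4) x) \<in> F5" using x(2) E5 False by blast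
          show ?thesis
          proof (cases "(u', t (k + 4) x) \<in> a (k + 5)")
            case True
            then have "link t a c q' u'" using q'x unfolding link_def 3 add_6 by blast
            then show ?thesis using old_res' c by blast
          next
            case False
            then have "u' = f" "t (k + 4) x = r" "F5 \<noteq> a (k + 5)" using u'x F5 by blast+
            then show ?thesis using 3 q'x by blast
          qed
        qed
      qed
    qed
    show ?thesis
    proof (cases "good g t a'")
      case True
      then show ?thesis using a' aa' by blast
    next
      case False
      then obtain s x where s: "F5 \<noteq> a (k + 5)" "(s, x) \<in> a (k + 4)" "t (k + 4) x = r"
        unfolding good_def using hole_link by blast
      have F5': "F5 = insert (f, r) (a (k + 5))" "r \<notin> Range (a (k + 5))" "g f \<noteq> f" "g f \<notin> Domain (a (k + 5))"
        using F5 s(1) by blast+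
      have E5': "E5 = insert (v5, p5) F5" and p5f0: "fresh 4 t (insert p (insert y W)) p5"
        using p5_fresh[OF s(1)] by blast+
      note p5f = fresh_iterates[OF p5f0]
      \<comment> \<open>The old point \<open>x\<close> of edge \<open>k + 4\<close> is a translate
        of \<open>p\<close>, so \<open>p\<close> is not fresh. Thus \<open>p\<close> already lay on
        edge \<open>k\<close>, and \<open>r\<close> filled a genuine hole.\<close>
      have E0': "E0 = a k"
      proof (rule ccontr)
        assume "E0 \<noteq> a k"
        then have pf: "fresh 4 t (insert y W) p" using E0 by blast
        have "finv (t (k + 4)) (finv (t (k + 5)) p) = x"
          unfolding r_def[symmetric] s(3)[symmetric] using t by simp
        then show False using fresh_iterates(6)[OF pf, of "k + 4" "k + 5"] RW[OF s(2)] by blast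
      qed
      have s_link: "link t a' (k + 4) s f"
        unfolding link_def add_6 a'_def
        using s(2,3) F5' E5' by (auto simp: E4_def F4_def)
      have fin_holes: "finite (holes t a)"
      proof (rule finite_subset)
        show "holes t a \<subseteq> UNIV \<times> (\<Union>c. Domain (a c)) \<times> (\<Union>c. Domain (a c))"
          unfolding holes_def by blast
        show "finite ((UNIV :: 6 set) \<times> (\<Union>c. Domain (a c)) \<times> (\<Union>c. Domain (a c)))"
          using fin by (simp add: finite_Domain)
      qed
      \<comment> \<open>A gap next to a new point is either excluded by freshness or, between
        consecutive points of the new hexagon, filled by that hexagon. Between \<open>r2\<close> and
        an old point of edge \<open>k + 4\<close> it is excluded by the third part of
        \<open>y_out\<close>.\<close>
      have sub: "holes t a' \<subseteq> holes t a"
      proof (rule subsetI)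
        fix h assume "h \<in> holes t a'"
        then obtain c q' r' x where h: "h = (c, q', r')" "c \<in> odd_6" "(q', x) \<in> a' c"
          "(r', t (c + 1) (t c x)) \<in> a' (c + 2)" "t c x \<notin> Range (a' (c + 1))"
          unfolding holes_def by blast
        have "t c x \<notin> Range (a (c + 1))" using h(5) aa' by blast
        moreover have "(q', x) \<in> a c \<and> (r', t (c + 1) (t c x)) \<in> a (c + 2)"
        proof -
          consider "c = k" | "c = k + 2" | "c = k + 4" using odd h(2) by blast
          then show ?thesis
          proof cases
            case 1
            have h': "(q', x) \<in> a k" "(r', t (k + 1) (t k x)) \<in> E2" "t k x \<notin> Range E1"
              using h(3-5) unfolding 1 a'_def by (simp_all add: E0')
            have "t (k + 1) (t k x) \<noteq> r2"
            proof
              assume "t (k + 1) (t k x) = r2"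
              then have "t k x = y" unfolding r2_def using aut_eq_iff[OF t] by blast
              then show False using h'(3) y(1) by blast
            qed
            moreover have "t (k + 1) (t k x) \<noteq> z2"
            proof
              assume "t (k + 1) (t k x) = z2"
              then have "finv (t k) (finv (t (k + 1)) (finv (t (k + 2)) z)) = x"
                unfolding z2_def[symmetric] using t by (metis aut_inv_apply(1))
              then show False using zf(7) RW[OF h'(1)] by blast
            qed
            ultimately show ?thesis using h'(1,2) unfolding 1 E2_def F2_def by blast
          next
            case 2
            have arith: "k + 2 + 2 = k + 4" by simp
            have h': "(q', x) \<in> E2" "(r', t (k + 3) (t (k + 2) x)) \<in> E4" "t (k + 2) x \<notin> Range E3"
              using h(3-5) unfolding 2 add_6 arith a'_def by simp_all
            have "x \<noteq> z2" using h'(3) tz2 unfolding E3_def by blast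
            moreover have np4: "t (k + 3) (t (k + 2) x) \<noteq> p4"
            proof
              assume "t (k + 3) (t (k + 2) x) = p4"
              then have "t (k + 2) x = r3" unfolding r3_def using t by (metis aut_inv_apply(1))
              then show False using h'(3) unfolding E3_def F3_def by blast
            qed
            moreover have np5: "t (k + 3) (t (k + 2) x) \<noteq> r4" if "x \<in> W \<or> x = r2"
            proof
              assume "t (k + 3) (t (k + 2) x) = r4"
              then have x3: "finv (t (k + 2)) (finv (t (k + 3)) (finv (t (k + 4)) p5)) = x"
                unfolding r4_def[symmetric] using t by (metis aut_inv_apply(1))
              then have "x \<notin> W" using p5f(7) by blast
              then have "x = r2" using that by blast
              then have "finv (t (k + 1)) (finv (t (k + 2)) (finv (t (k + 3)) (finv (t (k + 4)) p5))) = y"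
                unfolding x3 r2_def using t by simp
              then show False using p5f(8) by blast
            qed
            moreover have "x \<noteq> r2"
            proof
              assume x: "x = r2"
              then have "(r', t (k + 3) (t (k + 2) x)) \<in> a (k + 4)"
                using h'(2) np4 np5 unfolding E4_def F4_def by blast
              then show False using y_out(3) unfolding x r2_def by blast
            qed
            ultimately show ?thesis
              using h'(1,2) RW unfolding 2 add_6 arith E2_def F2_def E4_def F4_def by blast
          next
            case 3
            have arith: "k + 4 + 2 = k" by simp
            have h': "(q', x) \<in> E4" "(r', t (k + 5) (t (k + 4) x)) \<in> a k" "t (k + 4) x \<notin> Range E5"
              using h(3-5) unfolding 3 add_6 arith a'_def by (simp_all add: E0')
            have "x \<noteq> p4" using p4f(3) RW[OF h'(2)] by blast
            moreover have "x \<noteq> r4" using h'(3) tr4 p5(1) by blast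
            ultimately show ?thesis
              using h'(1,2) unfolding 3 add_6 arith E4_def F4_def by blast
          qed
        qed
        ultimately show "h \<in> holes t a" using h(1,2) unfolding holes_def by blast
      qed
      have arith: "k + 4 + 2 = k" by simp
      have "(k + 4, s, v0) \<in> holes t a"
        unfolding holes_def using s(2,3) F5'(2) p(1) E0' tr odd
        by (auto simp: add_6 arith)
      moreover have "(k + 4, s, v0) \<notin> holes t a'"
      proof
        assume "(k + 4, s, v0) \<in> holes t a'"
        then obtain x' where "(s, x') \<in> a' (k + 4)" "t (k + 4) x' \<notin> Range (a' (k + 4 + 1))"
          unfolding holes_def by blast
        then have x': "(s, x') \<in> E4" "t (k + 4) x' \<notin> Range E5"
          unfolding add_6 a'_def by simp_all
        have "(s, x) \<in> E4" using s(2) unfolding E4_def F4_def by blast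
        then have "x' = x"
          using partial_isoD(3)[OF p4(3)] x'(1) unfolding E4_def by blast
        then show False using x'(2) s(3) F5' F5E5 by blast
      qed
      ultimately have "holes t a' \<subset> holes t a" using sub by blast
      then have smaller: "card (holes t a') < card (holes t a)"
        by (rule psubset_card_mono[OF fin_holes])
      have "\<exists>a''. (\<forall>c. a' c \<subseteq> a'' c) \<and> state a'' \<and> good g t a''"
      proof (rule less.hyps[OF smaller a' _ s_link])
        show "k + 4 \<in> odd_6" using odd by blast
      next
        \<comment> \<open>\<open>g f\<close> can already have an image, namely \<open>p5\<close>,
          when \<open>g f = v5\<close>, that is, when \<open>g\<close> exchanges these two points.
          This is why \<open>resolve\<close> puts conditions on an existing image of
          \<open>g u\<close> instead of forbidding it.\<close>
        fix y' assume "(g f, y') \<in> a' (k + 4 + 1)"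
        then have "(g f, y') \<in> E5" unfolding add_6 a'_def by simp
        then have y': "y' = p5" using E5' F5' by blast
        have arith: "k + 4 + 2 = k" "k + 4 + 3 = k + 1" "k + 4 + 4 = k + 2" by simp_all
        have "t (k + 5) p5 \<notin> Range (a k)" using p5f(2) RW by blast
        moreover have "t k (t (k + 5) p5) \<notin> Range E1"
        proof
          assume "t k (t (k + 5) p5) \<in> Range E1"
          then have "t k (t (k + 5) p5) \<in> insert y W" using E1 RW by blast
          then show False using p5f(3) by blast
        qed
        moreover have "t (k + 1) (t k (t (k + 5) p5)) \<notin> Range E2"
        proof
          assume "t (k + 1) (t k (t (k + 5) p5)) \<in> Range E2"
          then consider "t (k + 1) (t k (t (k + 5) p5)) \<in> W"
            | "t (k + 1) (t k (t (k + 5) p5)) = r2" | "t (k + 1) (t k (t (k + 5) p5)) = z2"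
            using RW unfolding E2_def F2_def by blast
          then show False
          proof cases
            case 1
            then show False using p5f(4) by blast
          next
            case 2
            then have "t k (t (k + 5) p5) = y" unfolding r2_def using aut_eq_iff[OF t] by blast
            then show False using p5f(3) by blast
          next
            case 3
            then have "finv (t (k + 5)) (finv (t k) (finv (t (k + 1)) (finv (t (k + 2)) z))) = p5"
              unfolding z2_def[symmetric] using t by (metis aut_inv_apply(1))
            then show False using zf(8) by blast
          qed
        qed
        ultimately show "t (k + 4 + 1) y' \<notin> Range (a' (k + 4 + 2)) \<and>
          t (k + 4 + 2) (t (k + 4 + 1) y') \<notin> Range (a' (k + 4 + 3)) \<and>
          t (k + 4 + 3) (t (k + 4 + 2) (t (k + 4 + 1) y')) \<notin> Range (a' (k + 4 + 4))"
          unfolding y' arith add_6 a'_def by (simp add: E0')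
      next
        fix c q' u' assume c: "c \<in> odd_6" and l: "link t a' c q' u'"
        from hole_link[OF l c]
        show "resolved g t a' c q' u' \<or> c = k + 4 \<and> q' = s \<and> u' = f"
        proof (elim disjE conjE)
          assume "c = k + 4" "u' = f"
          then show ?thesis using l link_unique[OF a' t s_link] by blast
        qed blast
      qed
      then show ?thesis using aa' by (meson order_trans)
    qed
  qed
qed

end

section \<open>Back and forth\<close>

text \<open>
  Traversing the hexagon backwards replaces \<open>g\<close> by its inverse, and source points and
  target points of edges change roles.
\<close>

definition mirror :: "(6 \<Rightarrow> 'a \<Rightarrow> 'a) \<Rightarrow> (6 \<Rightarrow> ('a \<times> 'a) set) \<Rightarrow> 6 \<Rightarrow> ('a \<times> 'a) set" where
  "mirror t a e = (\<lambda>(u, x). (u, t (- e - 1) x)) ` a (- e - 1)"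

definition mirror_maps :: "(6 \<Rightarrow> 'a \<Rightarrow> 'a) \<Rightarrow> 6 \<Rightarrow> 'a \<Rightarrow> 'a" where
  "mirror_maps t e = finv (t (- e - 1))"

lemma minus_6: "- (- (c::6) - 1) - 1 = c" "- (c + 1) - 1 = - c - 2" "- (c::6) - 2 + 1 = - c - 1"
  by simp_all

text \<open>Edges are reflected by \<open>- e - 1\<close> but corners by \<open>- c - 2\<close>, as
  corner \<open>c\<close> lies between edges \<open>c\<close> and \<open>c + 1\<close>. So odd
  corners stay odd, while odd edges become even.\<close>

lemma odd_6_mirror: "c \<in> odd_6 \<Longrightarrow> - c - 2 \<in> odd_6"
  unfolding odd_6_def by auto

lemma odd_6_pred: "c \<notin> odd_6 \<Longrightarrow> c + 5 \<in> odd_6"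
  using UNIV_6[of 0] unfolding odd_6_def by auto

lemma odd_6_mirror_edge: "c \<in> odd_6 \<Longrightarrow> - c - 1 \<notin> odd_6"
  unfolding odd_6_def by auto

section \<open>Extending good states\<close>

lemma good_mono_links:
  assumes "good g t a" "\<And>c. a c \<subseteq> a' c"
    and "\<And>c q u. c \<in> odd_6 \<Longrightarrow> link t a' c q u \<Longrightarrow> link t a c q u"
  shows "good g t a'"
  using assms(1,3) resolved_mono[where a = a and a' = a', OF _ assms(2)] unfolding good_def by blast

context one_point_rich
begin

text \<open>A fresh image creates no link at all: at a new link, a translation or its inverse would
  carry it to an old point. So no hexagon has to be completed.\<close>

lemma extend_domain:
  assumes t: "\<And>c :: 6. aut (t c)" and a: "state a" "good g t a" and u: "u \<in> U"
  shows "\<exists>a'. (\<forall>c. a c \<subseteq> a' c) \<and> state a' \<and> good g t a' \<and> u \<in> Domain (a' k)"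
proof -
  note iso = stateD(2)[OF a(1)] and fin = stateD(1)[OF a(1)]
  define W where "W = (\<Union>c. Range (a c))"
  have W: "finite W" unfolding W_def using fin by (simp add: finite_Range)
  have RW: "y \<in> W" if "(s, y) \<in> a c" for s y c using that unfolding W_def by blast
  from ensure_domain[where t = t, OF iso[of k] fin u W t]
  obtain x E where x: "(u, x) \<in> E" "partial_iso E" "finite E"
    and E: "E = a k \<or> E = insert (u, x) (a k) \<and> u \<notin> Domain (a k) \<and> fresh 4 t W x"
    by (elim exE conjE)
  define a' where "a' = a(k := E)"
  have aa': "a c \<subseteq> a' c" for c using E unfolding a'_def by auto
  have "state a'" using a(1) x(2,3) unfolding state_def a'_def by simp
  moreover have "good g t a'"
  proof (rule good_mono_links[OF a(2) aa'])
    fix c q w assume "link t a' c q w"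
    then obtain y where y: "(q, y) \<in> a' c" "(w, t c y) \<in> a' (c + 1)"
      unfolding link_def by blast
    show "link t a c q w"
    proof (rule ccontr)
      assume "\<not> link t a c q w"
      then have "(q, y) \<notin> a c \<or> (w, t c y) \<notin> a (c + 1)" unfolding link_def by blast
      then have "a' \<noteq> a" using y by metis
      then have neq: "E \<noteq> a k" unfolding a'_def by auto
      then have xf: "fresh 4 t W x" and E': "E = insert (u, x) (a k)" using E by blast+
      show False
      proof (cases "c = k")
        case True
        then have "(w, t c y) \<in> a (c + 1)" using y(2) unfolding a'_def by simp
        moreover from this have "y = x" using \<open>\<not> link t a c q w\<close> y(1) True E'
          unfolding link_def a'_def by auto
        ultimately show False using fresh_iterates(2)[OF xf] RW by blast
      next
        case False
        then have qy: "(q, y) \<in> a c" using y(1) unfolding a'_def by simp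
        then have "t c y = x" using \<open>\<not> link t a c q w\<close> y(2) E'
          unfolding link_def a'_def by (auto split: if_splits)
        then have "finv (t c) x = y" using t by auto
        then show False using fresh_iterates(5)[OF xf] RW[OF qy] by blast
      qed
    qed
  qed
  moreover have "u \<in> Domain (a' k)" using x(1) unfolding a'_def by auto
  ultimately show ?thesis using aa' by blast
qed

text \<open>For even \<open>k\<close> only the corner \<open>j\<close> before edge \<open>k\<close>
  is odd. All new odd links depart via the one point \<open>u\<close>, so there is at most one, and
  \<open>g u\<close> is still undefined when \<open>resolve\<close> is called.\<close>

lemma extend_range_even:
  assumes g: "aut g" "g \<noteq> id" and t: "\<And>c :: 6. aut (t c)"
    and a: "state a" "good g t a" and x: "x \<in> U" and k: "k \<notin> odd_6"
  shows "\<exists>a'. (\<forall>c. a c \<subseteq> a' c) \<and> state a' \<and> good g t a' \<and> x \<in> Range (a' k)"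
proof (cases "x \<in> Range (a k)")
  case True
  then show ?thesis using a by blast
next
  case False
  note iso = stateD(2)[OF a(1)] and fin = stateD(1)[OF a(1)]
  define j where "j = k + 5"
  have j: "j \<in> odd_6" "j + 1 = k" "j \<noteq> k"
    using odd_6_pred[OF k] unfolding j_def by simp_all
  have "finite (Domain (a k))" using fin by (simp add: finite_Domain)
  from ex_moved_extension[OF iso fin x False this g]
  obtain u where u: "u \<notin> Domain (a k)" "g u \<noteq> u" "g u \<notin> Domain (a k)"
    and E: "partial_iso (insert (u, x) (a k))" by blast
  define b where "b = a(k := insert (u, x) (a k))"
  have ab: "a c \<subseteq> b c" for c unfolding b_def by auto
  have b: "state b" using a(1) E unfolding state_def b_def by simp
  have new_link: "link t a c q w \<or> c = j \<and> w = u" if "c \<in> odd_6" "link t b c q w" for c q w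
  proof -
    have ck: "c \<noteq> k" using that(1) k by blast
    from that(2) obtain y where y: "(q, y) \<in> b c" "(w, t c y) \<in> b (c + 1)"
      unfolding link_def by blast
    have qy: "(q, y) \<in> a c" using y(1) ck unfolding b_def by simp
    show ?thesis
    proof (cases "c + 1 = k")
      case True
      then have "c = j" using j(2) by (metis add_right_cancel)
      moreover have "w = u \<or> (w, t c y) \<in> a (c + 1)" using y(2) True unfolding b_def by auto
      ultimately show ?thesis using qy unfolding link_def by blast
    next
      case False
      then show ?thesis using y(2) qy unfolding link_def b_def by auto
    qed
  qed
  have xb: "x \<in> Range (b k)" unfolding b_def by auto
  show ?thesis
  proof (cases "\<exists>q. link t b j q u")
    case False
    have "good g t b"
      by (rule good_mono_links[OF a(2) ab]) (use new_link False in blast)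
    then show ?thesis using b ab xb by blast
  next
    case True
    then obtain q where q: "link t b j q u" by blast
    have "\<exists>a'. (\<forall>c. b c \<subseteq> a' c) \<and> state a' \<and> good g t a'"
    proof (rule resolve[OF g t b j(1) q])
      fix y assume "(g u, y) \<in> b (j + 1)"
      then have False using u(2,3) unfolding j(2) b_def by auto
      then show "t (j + 1) y \<notin> Range (b (j + 2)) \<and> t (j + 2) (t (j + 1) y) \<notin> Range (b (j + 3)) \<and>
          t (j + 3) (t (j + 2) (t (j + 1) y)) \<notin> Range (b (j + 4))" by blast
    next
      fix c q' u' assume c: "c \<in> odd_6" and l: "link t b c q' u'"
      from new_link[OF this] show "resolved g t b c q' u' \<or> c = j \<and> q' = q \<and> u' = u"
      proof
        assume "link t a c q' u'"
        then have "resolved g t a c q' u'" using a(2) c unfolding good_def by blast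
        from resolved_mono[OF this ab] show ?thesis by blast
      next
        assume "c = j \<and> u' = u"
        then show ?thesis using l link_unique[OF b t q] by blast
      qed
    qed
    then obtain a' where a': "\<And>c. b c \<subseteq> a' c" "state a'" "good g t a'" by blast
    have "a c \<subseteq> a' c" for c using ab a'(1) by blast
    moreover have "x \<in> Range (a' k)" using xb a'(1) by blast
    ultimately show ?thesis using a'(2,3) by blast
  qed
qed

text \<open>In the mirror image the points of every edge are moved by that edge's own translation.
  Walking backwards, the inverse translation then leads to the coordinates of the preceding
  edge.\<close>

lemma link_mirror:
  assumes t: "\<And>c :: 6. aut (t c)"
  shows "link (mirror_maps t) (mirror t a) e q w \<longleftrightarrow> link t a (- e - 2) w q"
proof
  assume "link (mirror_maps t) (mirror t a) e q w"
  then obtain x0 x1 where "(q, x0) \<in> a (- e - 1)" "(w, x1) \<in> a (- (e + 1) - 1)"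
    "mirror_maps t e (t (- e - 1) x0) = t (- (e + 1) - 1) x1"
    unfolding link_def mirror_def by auto
  moreover from this(3) have "x0 = t (- (e + 1) - 1) x1"
    unfolding mirror_maps_def using t by simp
  ultimately show "link t a (- e - 2) w q"
    unfolding link_def minus_6(2,3) by blast
next
  assume "link t a (- e - 2) w q"
  then obtain x where x: "(w, x) \<in> a (- e - 2)" "(q, t (- e - 2) x) \<in> a (- e - 1)"
    unfolding link_def minus_6(3) by blast
  have "(q, t (- e - 1) (t (- e - 2) x)) \<in> mirror t a e"
    unfolding mirror_def using x(2) by force
  moreover have "(w, t (- e - 2) x) \<in> mirror t a (e + 1)"
    unfolding mirror_def minus_6(2) using x(1) by force
  moreover have "mirror_maps t e (t (- e - 1) (t (- e - 2) x)) = t (- e - 2) x"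
    unfolding mirror_maps_def using t by simp
  ultimately show "link (mirror_maps t) (mirror t a) e q w"
    unfolding link_def by metis
qed

lemma good_mirror:
  assumes t: "\<And>c :: 6. aut (t c)" and g: "aut g" and "good g t a"
  shows "good (finv g) (mirror_maps t) (mirror t a)"
  unfolding good_def
proof (intro ballI allI impI)
  fix e q w assume e: "e \<in> odd_6" and "link (mirror_maps t) (mirror t a) e q w"
  then have "link t a (- e - 2) w q" using link_mirror[where t = t, OF t] by blast
  then have "resolved g t a (- e - 2) w q" using assms(3) odd_6_mirror[OF e] unfolding good_def by blast
  then obtain v where v: "polygon g t a v" "g (v (- e - 2)) = w" "v (- e - 2 + 1) = q"
    unfolding resolved_def by blast
  \<comment> \<open>A reversed edge starts at the end of the original edge, hence the application of
    \<open>g\<close>.\<close>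
  define v' where "v' d = g (v (- d - 1))" for d
  have "polygon (finv g) (mirror_maps t) (mirror t a) v'"
    unfolding polygon_def link_mirror[where t = t, OF t]
  proof
    fix c
    have "link t a (- c - 2) (g (v (- c - 2))) (v (- c - 2 + 1))" using v(1) unfolding polygon_def by blast
    then show "link t a (- c - 2) (v' (c + 1)) (finv g (v' c))"
      unfolding v'_def minus_6(2,3) using g by simp
  qed
  moreover have "finv g (v' e) = q" unfolding v'_def using g v(3) minus_6(3) by simp
  moreover have "v' (e + 1) = w" unfolding v'_def minus_6(2) by (rule v(2))
  ultimately show "resolved (finv g) (mirror_maps t) (mirror t a) e q w"
    unfolding resolved_def by blast
qed

lemma state_mirror:
  assumes t: "\<And>c :: 6. aut (t c)" and "state a"
  shows "state (mirror t a)"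
  using stateD[OF assms(2)] partial_iso_aut_snd t unfolding state_def mirror_def by blast

lemma mirror_maps_mirror: "(\<And>c :: 6. aut (t c)) \<Longrightarrow> mirror_maps (mirror_maps t) = t"
  unfolding mirror_maps_def minus_6(1) using aut_inv_inv by blast

lemma mirror_mirror:
  assumes t: "\<And>c :: 6. aut (t c)"
  shows "mirror (mirror_maps t) (mirror t a) = a"
proof
  fix c
  show "mirror (mirror_maps t) (mirror t a) c = a c"
    unfolding mirror_def mirror_maps_def minus_6(1)
    using t by (simp add: image_image case_prod_unfold)
qed

text \<open>For odd \<open>k\<close> the odd corner lies behind edge \<open>k\<close>, the side
  opposite to the one \<open>resolve\<close> is made for. Reflection exchanges the two sides and
  turns \<open>k\<close> into an even edge.\<close>

lemma extend_range:
  assumes g: "aut g" "g \<noteq> id" and t: "\<And>c :: 6. aut (t c)"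
    and a: "state a" "good g t a" and x: "x \<in> U"
  shows "\<exists>a'. (\<forall>c. a c \<subseteq> a' c) \<and> state a' \<and> good g t a' \<and> x \<in> Range (a' k)"
proof (cases "k \<in> odd_6")
  case False
  from extend_range_even[where t = t, OF g t a x this] show ?thesis .
next
  case True
  have g': "aut (finv g)" "finv g \<noteq> id"
    using aut_inv[OF g(1)] aut_inv_inv[OF g(1)] g(2) by (metis inv_id)+
  have t': "aut (mirror_maps t c)" for c
    unfolding mirror_maps_def using aut_inv t by blast
  \<comment> \<open>Mirrored ranges are shifted by the translation, so \<open>t k x\<close> is the
    point to be added in place of \<open>x\<close>.\<close>
  have "t k x \<in> U" using aut_in_iff[OF t] x by blast
  from extend_range_even[where t = "mirror_maps t", OF g' t' state_mirror[where t = t, OF t a(1)] good_mirror[where t = t, OF t g(1) a(2)] this odd_6_mirror_edge[OF True]]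
  obtain b where b: "\<And>c. mirror t a c \<subseteq> b c" "state b" "good (finv g) (mirror_maps t) b"
    "t k x \<in> Range (b (- k - 1))" by blast
  define a' where "a' = mirror (mirror_maps t) b"
  have "mirror (mirror_maps t) (mirror t a) c \<subseteq> a' c" for c
    using b(1)[of "- c - 1"] unfolding a'_def mirror_def[of "mirror_maps t"] by (rule image_mono)
  then have "a c \<subseteq> a' c" for c unfolding mirror_mirror[where t = t, OF t] .
  moreover have "state a'" unfolding a'_def by (rule state_mirror[where t = "mirror_maps t", OF t' b(2)])
  moreover have "good g t a'"
    using good_mirror[where t = "mirror_maps t", OF t' g'(1) b(3)] unfolding mirror_maps_mirror[where t = t, OF t] aut_inv_inv[OF g(1)] a'_def .
  moreover obtain s where "(s, t k x) \<in> b (- k - 1)" using b(4) by blast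
  then have "(s, mirror_maps t (- k - 1) (t k x)) \<in> a' k"
    unfolding a'_def mirror_def by force
  then have "x \<in> Range (a' k)"
    unfolding mirror_maps_def minus_6(1) using t by auto
  ultimately show ?thesis by blast
qed

section \<open>The limit of the finite approximations\<close>

lemma partial_iso_UN:
  assumes "\<And>i::nat. partial_iso (S i)" "mono S"
  shows "partial_iso (\<Union>i. S i)"
proof -
  have fin: "\<exists>i. X \<subseteq> S i" if "finite X" "X \<subseteq> (\<Union>i. S i)" for X
    using that
  proof (induction X)
    case (insert e X)
    then obtain i j where "X \<subseteq> S i" "e \<in> S j" by auto
    then have "insert e X \<subseteq> S (max i j)"
      using monoD[OF assms(2), of i "max i j"] monoD[OF assms(2), of j "max i j"] by auto
    then show ?case by blast
  qed simp
  show ?thesis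
    unfolding partial_iso_def
  proof (intro conjI ballI allI impI)
    show "(\<Union>i. S i) \<subseteq> U \<times> U" using partial_isoD(1,2)[OF assms(1)] by auto
  next
    fix p q assume "p \<in> (\<Union>i. S i)" "q \<in> (\<Union>i. S i)"
    then obtain i where "{p, q} \<subseteq> S i" using fin[of "{p, q}"] by blast
    then show "fst p = fst q \<longleftrightarrow> snd p = snd q"
      using partial_isoD(3)[OF assms(1), of "fst p" "snd p" i "fst q" "snd q"] by simp
  next
    fix ps assume "set ps \<subseteq> (\<Union>i. S i)"
    then obtain i where "set ps \<subseteq> S i" using fin[of "set ps"] by blast
    from partial_isoD(4)[OF assms(1) this] show "map fst ps \<in> R \<longleftrightarrow> map snd ps \<in> R" .
  qed
qed

lemma aut_of_total_partial_iso:
  assumes E: "partial_iso E" and "Domain E = U" "Range E = U"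
  shows "\<exists>f. aut f \<and> (\<forall>(u, x)\<in>E. f u = x)"
proof -
  define f where "f u = (if u \<in> U then THE x. (u, x) \<in> E else u)" for u
  have f: "f u = x" if "(u, x) \<in> E" for u x
  proof -
    have "(THE x. (u, x) \<in> E) = x"
      by (rule the_equality, rule that) (use partial_isoD(3)[OF E that] in blast)
    then show ?thesis using partial_isoD(1)[OF E that] by (simp add: f_def)
  qed
  have fE: "(u, f u) \<in> E" if u: "u \<in> U" for u
  proof -
    obtain x where "(u, x) \<in> E" using u assms(2) by blast
    then show ?thesis using f by blast
  qed
  have "bij_betw f U U"
    unfolding bij_betw_def
  proof
    show "inj_on f U"
    proof (rule inj_onI)
      fix u v assume "u \<in> U" "v \<in> U" "f u = f v"
      then show "u = v" using partial_isoD(3)[OF E fE fE, of u v] by blast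
    qed
    show "f ` U = U"
    proof
      show "f ` U \<subseteq> U" using partial_isoD(2)[OF E fE] by blast
      show "U \<subseteq> f ` U"
      proof
        fix x assume "x \<in> U"
        then obtain u where u: "(u, x) \<in> E" using assms(3) by blast
        from f[OF u] partial_isoD(1)[OF E u] show "x \<in> f ` U" by blast
      qed
    qed
  qed
  then have "f permutes U" by (rule bij_imp_permutes) (simp add: f_def)
  moreover have "map f xs \<in> R \<longleftrightarrow> xs \<in> R" if "set xs \<subseteq> U" for xs
  proof -
    have "set (map (\<lambda>u. (u, f u)) xs) \<subseteq> E" using fE that by auto
    from partial_isoD(4)[OF E this] show ?thesis by (simp add: comp_def)
  qed
  ultimately have "aut f" unfolding aut_def by blast
  then show ?thesis using f by blast
qed

lemma ex_total_good:
  assumes g: "aut g" "g \<noteq> id" and t: "\<And>c :: 6. aut (t c)"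
  shows "\<exists>A. (\<forall>c. partial_iso (A c) \<and> Domain (A c) = U \<and> Range (A c) = U) \<and> good g t A"
proof -
  \<comment> \<open>A task asks for a point to enter the domain or the range at one edge. Treating
    each task once suffices, since domains and ranges only grow.\<close>
  define tasks where "tasks = (UNIV :: 6 set) \<times> U \<times> (UNIV :: bool set)"
  have "countable tasks" unfolding tasks_def
    using countable_U by (intro countable_SIGMA) (auto intro: countable_finite)
  moreover have "tasks \<noteq> {}" unfolding tasks_def using infinite_U by auto
  ultimately obtain task :: "nat \<Rightarrow> 6 \<times> 'a \<times> bool" where task: "range task = tasks"
    using range_from_nat_into by metis
  define fulfilled where "fulfilled i b \<longleftrightarrow>
      (case task i of (c, x, d) \<Rightarrow> if d then x \<in> Domain (b c) else x \<in> Range (b c))"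
    for i and b :: "6 \<Rightarrow> ('a \<times> 'a) set"
  have "\<exists>S. \<forall>i. (state (S i) \<and> good g t (S i)) \<and> ((\<forall>c. S i c \<subseteq> S (Suc i) c) \<and> fulfilled i (S (Suc i)))"
  proof (rule dependent_nat_choice)
    show "\<exists>a. state a \<and> good g t a"
      by (rule exI[of _ "\<lambda>_. {}"]) (simp add: state_def good_def link_def partial_iso_empty)
  next
    fix a i assume a: "state a \<and> good g t a"
    obtain c x d where cxd: "task i = (c, x, d)" by (cases "task i") auto
    then have x: "x \<in> U" using task unfolding tasks_def by (metis SigmaD1 SigmaD2 rangeI)
    have "\<exists>b. (\<forall>c. a c \<subseteq> b c) \<and> state b \<and> good g t b \<and> fulfilled i b"
    proof (cases d)
      case True
      have "fulfilled i b \<longleftrightarrow> x \<in> Domain (b c)" for b using True cxd by (simp add: fulfilled_def)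
      then show ?thesis using extend_domain[where t = t, OF t a[THEN conjunct1] a[THEN conjunct2] x, of c] by simp
    next
      case False
      have "fulfilled i b \<longleftrightarrow> x \<in> Range (b c)" for b using False cxd by (simp add: fulfilled_def)
      then show ?thesis using extend_range[where t = t, OF g t a[THEN conjunct1] a[THEN conjunct2] x, of c] by simp
    qed
    then show "\<exists>b. (state b \<and> good g t b) \<and> ((\<forall>c. a c \<subseteq> b c) \<and> fulfilled i b)" by blast
  qed
  then obtain S where S: "\<And>i. state (S i)" "\<And>i. good g t (S i)"
    "\<And>i c. S i c \<subseteq> S (Suc i) c" "\<And>i. fulfilled i (S (Suc i))" by blast
  define A where "A c = (\<Union>i. S i c)" for c
  have inc: "mono (\<lambda>i. S i c)" for c using S(3) by (simp add: mono_iff_le_Suc)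
  have SA: "S i c \<subseteq> A c" for i c unfolding A_def by blast
  have A: "partial_iso (A c)" for c
    unfolding A_def using stateD(2)[OF S(1)] inc by (rule partial_iso_UN)
  have total: "x \<in> Domain (A c) \<and> x \<in> Range (A c)" if "x \<in> U" for x c
  proof -
    have "(c, x, True) \<in> range task" "(c, x, False) \<in> range task"
      using that unfolding task tasks_def by auto
    then obtain i j where ij: "task i = (c, x, True)" "task j = (c, x, False)" by (metis rangeE)
    have "x \<in> Domain (S (Suc i) c)" "x \<in> Range (S (Suc j) c)"
      using S(4)[of i] S(4)[of j] ij unfolding fulfilled_def by simp_all
    then show ?thesis using SA by blast
  qed
  have "Domain (A c) = U \<and> Range (A c) = U" for c
    using total partial_isoD(1,2)[OF A] by blast
  \<comment> \<open>A link consists of two pairs and so appears at a finite stage; its hexagon at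
    that stage persists in the limit.\<close>
  moreover have "good g t A"
    unfolding good_def
  proof (intro ballI allI impI)
    fix c q u assume c: "c \<in> odd_6" and "link t A c q u"
    then obtain x i j where "(q, x) \<in> S i c" "(u, t c x) \<in> S j (c + 1)"
      unfolding link_def A_def by blast
    then have "link t (S (max i j)) c q u"
      unfolding link_def using monoD[OF inc[of c], of i "max i j"] monoD[OF inc[of "c + 1"], of j "max i j"] by auto
    then have "resolved g t (S (max i j)) c q u" using S(2) c unfolding good_def by blast
    from resolved_mono[OF this SA] show "resolved g t A c q u" .
  qed
  ultimately show ?thesis using A by blast
qed

lemma product_of_six_conjugates:
  assumes g: "aut g" "g \<noteq> id" and h: "aut h"
  shows "\<exists>f0 f1 f2 f3 f4 f5. aut f0 \<and> aut f1 \<and> aut f2 \<and> aut f3 \<and> aut f4 \<and> aut f5 \<and>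
    h = (f5 \<circ> g \<circ> finv f5) \<circ> (f4 \<circ> g \<circ> finv f4) \<circ> (f3 \<circ> g \<circ> finv f3) \<circ>
        (f2 \<circ> g \<circ> finv f2) \<circ> (f1 \<circ> g \<circ> finv f1) \<circ> (f0 \<circ> g \<circ> finv f0)"
proof -
  \<comment> \<open>A hexagon closes when the inverse of \<open>h\<close> brings the end of the
    sixth conjugate back to the start of the first.\<close>
  define t where "t c = (if c = (5::6) then finv h else id)" for c
  have t: "aut (t c)" for c
    by (cases "c = 5") (simp_all add: t_def aut_inv[OF h] aut_id)
  from ex_total_good[where t = t, OF g t]
  obtain A where A_total: "\<forall>c. partial_iso (A c) \<and> Domain (A c) = U \<and> Range (A c) = U"
    and A_good: "good g t A" by (elim exE conjE)
  have A: "partial_iso (A c)" "Domain (A c) = U" "Range (A c) = U" for c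
    using A_total by blast+
  have "\<forall>c. \<exists>f. aut f \<and> (\<forall>(u, x)\<in>A c. f u = x)"
    using aut_of_total_partial_iso[OF A] by blast
  then obtain f where f': "\<forall>c. aut (f c) \<and> (\<forall>(u, x)\<in>A c. f c u = x)"
    by (elim choice[THEN exE])
  have f: "aut (f c)" "(u, x) \<in> A c \<Longrightarrow> f c u = x" for c u x
    using f' by fastforce+
  define K where "K c = f c \<circ> g \<circ> finv (f c)" for c
  have K: "aut (K c)" for c unfolding K_def using f(1) g(1) aut_inv aut_comp by blast
  have "h x = (K 5 \<circ> K 4 \<circ> K 3 \<circ> K 2 \<circ> K 1 \<circ> K 0) x" for x
  proof (cases "x \<in> U")
    case False
    then have "K c x = x" "h x = x" for c
      using aut_permutes[OF K] aut_permutes[OF h] permutes_not_in by metis+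
    then show ?thesis by simp
  next
    case True
    have wrap: "(5::6) + 1 = 0" by simp
    \<comment> \<open>Since the maps are total, \<open>h x\<close> on edge 5 and \<open>x\<close> on
      edge 0 form a link at the odd corner 5. Goodness at this single corner yields the hexagon that
      traces all six conjugates from \<open>x\<close> to \<open>h x\<close>.\<close>
    obtain u where u: "(u, x) \<in> A 0" using True A(3) by blast
    have "t 5 (h x) = x" unfolding t_def using h by simp
    moreover have "h x \<in> U" using aut_in_iff[OF h] True by blast
    then obtain q where "(q, h x) \<in> A 5" using A(3) by blast
    ultimately have "link t A 5 q u" unfolding link_def wrap using u by auto
    moreover have "5 \<in> odd_6" unfolding odd_6_def by simp
    ultimately obtain v where v: "polygon g t A v" "g (v 5) = q" "v 0 = u"
      using A_good unfolding good_def resolved_def wrap[symmetric] by blast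
    have step: "K c (f c (v c)) = finv (t c) (f (c + 1) (v (c + 1)))" for c
    proof -
      have "link t A c (g (v c)) (v (c + 1))" using v(1) unfolding polygon_def by blast
      then obtain y where "(g (v c), y) \<in> A c" "(v (c + 1), t c y) \<in> A (c + 1)"
        unfolding link_def by blast
      then have y: "f c (g (v c)) = y" "f (c + 1) (v (c + 1)) = t c y" using f(2) by blast+
      have "K c (f c (v c)) = f c (g (v c))" unfolding K_def using f(1) by simp
      then show ?thesis using y t by simp
    qed
    have "f 0 (v 0) = x" using v(3) f(2)[OF u] by simp
    then have "K 0 x = f 1 (v 1)" "K 1 (f 1 (v 1)) = f 2 (v 2)" "K 2 (f 2 (v 2)) = f 3 (v 3)"
      "K 3 (f 3 (v 3)) = f 4 (v 4)" "K 4 (f 4 (v 4)) = f 5 (v 5)" "K 5 (f 5 (v 5)) = h x"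
      using step[of 0] step[of 1] step[of 2] step[of 3] step[of 4] step[of 5, unfolded wrap] aut_inv_inv[OF h]
      by (simp_all add: t_def)
    then show ?thesis by simp
  qed
  then have "h = K 5 \<circ> K 4 \<circ> K 3 \<circ> K 2 \<circ> K 1 \<circ> K 0" by blast
  then show ?thesis using f(1) unfolding K_def by blast
qed

end

section \<open>Normal subgroups of the automorphism group\<close>

lemma group_Aut: "group (Aut T)"
proof (rule groupI)
  let ?U = "univ T"
  have in_U: "set (map p xs) \<subseteq> ?U" if "p permutes ?U" "set xs \<subseteq> ?U" for p xs
    using that by (auto simp: permutes_in_image)
  fix p q r assume "p \<in> carrier (Aut T)" "q \<in> carrier (Aut T)"
  then have p: "p permutes ?U" "\<And>xs. set xs \<subseteq> ?U \<Longrightarrow> xs \<in> rel T \<longleftrightarrow> map p xs \<in> rel T"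
    and q: "q permutes ?U" "\<And>xs. set xs \<subseteq> ?U \<Longrightarrow> xs \<in> rel T \<longleftrightarrow> map q xs \<in> rel T"
    by (auto simp: Aut_def automorphisms_def isomorphism_def)
  have "p \<circ> q permutes ?U" using p(1) q(1) by (rule permutes_compose[rotated])
  moreover have "xs \<in> rel T \<longleftrightarrow> map (p \<circ> q) xs \<in> rel T" if "set xs \<subseteq> ?U" for xs
    using q(2)[OF that] p(2)[OF in_U[OF q(1) that]] by simp
  ultimately show "p \<otimes>\<^bsub>Aut T\<^esub> q \<in> carrier (Aut T)"
    by (simp add: Aut_def automorphisms_def isomorphism_def permutes_imp_bij)
  have p': "finv p permutes ?U" using permutes_inv[OF p(1)] .
  have "xs \<in> rel T \<longleftrightarrow> map (finv p) xs \<in> rel T" if "set xs \<subseteq> ?U" for xs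
    using p(2)[OF in_U[OF p' that]] permutes_inverses(1)[OF p(1)] by (simp add: comp_def)
  with p' have "finv p \<in> carrier (Aut T)"
    by (simp add: Aut_def automorphisms_def isomorphism_def permutes_imp_bij)
  moreover have "finv p \<circ> p = id" using permutes_inv_o(2)[OF p(1)] .
  ultimately show "\<exists>r\<in>carrier (Aut T). r \<otimes>\<^bsub>Aut T\<^esub> p = \<one>\<^bsub>Aut T\<^esub>"
    by (auto simp: Aut_def)
qed (auto simp: Aut_def automorphisms_def isomorphism_def permutes_id comp_assoc)

theorem theoremA:
  fixes T :: "'a rel_struct" and n :: nat
  assumes "n \<ge> 3" and "generic_hypertournament n T"
  shows "is_simple_group (Aut T)"
proof -
  interpret one_point_rich "univ T" "rel T" n
    by (rule generic_one_point_rich[OF assms])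
  interpret group "Aut T" by (rule group_Aut)
  have carrier: "carrier (Aut T) = {f. aut f}"
    unfolding Aut_def automorphisms_def isomorphism_def aut_def
    by (auto simp: permutes_imp_bij)
  have mult: "f \<otimes>\<^bsub>Aut T\<^esub> g = f \<circ> g" and one: "\<one>\<^bsub>Aut T\<^esub> = id" for f g
    by (simp_all add: Aut_def)
  have inv: "inv\<^bsub>Aut T\<^esub> f = finv f" if "aut f" for f
  proof (rule inv_equality)
    show "finv f \<otimes>\<^bsub>Aut T\<^esub> f = \<one>\<^bsub>Aut T\<^esub>"
      unfolding mult one using permutes_inv_o(2)[OF aut_permutes[OF that]] .
  qed (use that aut_inv in \<open>auto simp: carrier\<close>)
  have "\<exists>f. aut f \<and> f \<noteq> id"
  proof -
    obtain x where x: "x \<in> univ T" using infinite_imp_nonempty[OF infinite_U] by blast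
    have "infinite (univ T - {x})" using infinite_U by simp
    from infinite_imp_nonempty[OF this] obtain y where y: "y \<in> univ T" "y \<noteq> x" by blast
    have no_rel: "xs \<notin> rel T" if "set xs \<subseteq> {z}" for xs z
    proof
      assume "xs \<in> rel T"
      then have "card (set xs) = n" using R_distinct R_length by (metis distinct_card)
      then show False using card_mono[OF _ that] assms(1) by simp
    qed
    \<comment> \<open>No tuple of the relation lives on a single point, so any two one-point
      substructures are isomorphic, and ultrahomogeneity supplies an automorphism that moves
      \<open>x\<close>.\<close>
    have "isomorphism (\<lambda>_. y) (substructure T {x}) (substructure T {y})"
      unfolding isomorphism_def substructure_def
      using no_rel by (auto simp: bij_betw_def)
    then obtain p where "p \<in> automorphisms T" "\<forall>z\<in>{x}. p z = y"
      using assms(2) x y(1) unfolding generic_hypertournament_def ultrahomogeneous_def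
      by (metis empty_subsetI finite.emptyI finite.insertI insert_subset)
    then show ?thesis using y(2) carrier by (auto simp: Aut_def)
  qed
  then have "carrier (Aut T) \<noteq> {\<one>\<^bsub>Aut T\<^esub>}" unfolding carrier one by blast
  moreover have "H = {\<one>\<^bsub>Aut T\<^esub>} \<or> H = carrier (Aut T)" if "H \<lhd> Aut T" for H
  proof (cases "H \<subseteq> {id}")
    case True
    then show ?thesis
      using subgroup.one_closed[OF normal_imp_subgroup[OF that]] unfolding one by blast
  next
    case False
    have sub: "subgroup H (Aut T)" using that by (rule normal_imp_subgroup)
    from False obtain g where g: "g \<in> H" "g \<noteq> id" by blast
    then have aut_g: "aut g" using subgroup.subset[OF sub] carrier by blast
    have conj: "f \<circ> g \<circ> finv f \<in> H" if "aut f" for f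
      using normal.inv_op_closed2[OF \<open>H \<lhd> Aut T\<close> _ g(1), of f] that
      by (simp add: carrier mult inv)
    have comp: "p \<circ> q \<in> H" if "p \<in> H" "q \<in> H" for p q
      using subgroup.m_closed[OF sub that] by (simp add: mult)
    have "h \<in> H" if "aut h" for h
    proof -
      from product_of_six_conjugates[OF aut_g g(2) that]
      obtain f0 f1 f2 f3 f4 f5 where "aut f0" "aut f1" "aut f2" "aut f3" "aut f4" "aut f5"
        and "h = (f5 \<circ> g \<circ> finv f5) \<circ> (f4 \<circ> g \<circ> finv f4) \<circ> (f3 \<circ> g \<circ> finv f3) \<circ>
        (f2 \<circ> g \<circ> finv f2) \<circ> (f1 \<circ> g \<circ> finv f1) \<circ> (f0 \<circ> g \<circ> finv f0)" by blast
      then show ?thesis using conj comp by presburger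
    qed
    then show ?thesis using subgroup.subset[OF sub] carrier by blast
  qed
  ultimately show ?thesis unfolding is_simple_group_def using group_Aut by blast
qed

end
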